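(* Let $\mathcal D$ be a directed acyclic graph with finite vertex set $V$ and let $\mathcal Q=\{Q_{v|\operatorname{pa}(v)}:v\in V\}$ be a family of quantum kernels for $\mathcal D$. Suppose that their canonical embeddings into the operators on $\mathcal H_V$ commute pairwise. Then, for every topological ordering $<$ of $\mathcal D$, $$\Phi_{\mathcal D,<}(\mathcal Q)=\prod_{v\in V}Q_{v|\operatorname{pa}(v)}=:\omega$$ is the same state. Moreover, $Q_{v|\operatorname{pa}(v)}=\omega_{v|\operatorname{pa}(v)}$ for all $v\in V$, and the extrinsic construction agrees with the intrinsic factorization of $\omega$, i.e. for every topological ordering $v_1<\cdots<v_n$, $$\omega=\omega_{v_n|\operatorname{pa}(v_n)}\star\bigl(\omega_{v_{n-1}|\operatorname{pa}(v_{n-1})}\star\cdots\star(\omega_{v_2|\operatorname{pa}(v_2)}\star\omega_{v_1})\cdots\bigr).$$ Consequently, $\omega$ satisfies all three directed Markov properties (O), (L) and (G) with respect to $\mathcal D$.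
   Context: For each $v\in V$, $\mathcal H_v$ is a finite-dimensional complex Hilbert space; $\mathcal H_A=\bigotimes_{v\in A}\mathcal H_v$ for $A\subseteq V$, with $\mathcal H_\varnothing=\mathbb C$. The canonical embedding of an operator on $\mathcal H_A$ into operators on a larger tensor product tensors it with the identity on the complementary factors; embeddings are left implicit. For positive definite $M,N$ on the same space, $M\star N:=N^{1/2}MN^{1/2}$. For a positive definite density operator $\omega$ on $\mathcal H_V$, $\omega_A=\operatorname{Tr}_{V\setminus A}(\omega)$, and for disjoint $A,B$, $\omega_{A|B}:=\omega_B^{-1/2}\omega_{A\cup B}\omega_B^{-1/2}$ (so $\omega_{A|\varnothing}=\omega_A$). For a vertex $v$ of $\mathcal D$: $\operatorname{pa}(v)$ is its set of parents, $\operatorname{de}(v)$ its set of descendants (excluding $v$), $\operatorname{nd}(v)=V\setminus(\{v\}\cup\operatorname{de}(v))$. A total ordering $<$ of $V$ is topological if $u<w$ for every arrow $u\to w$; $\operatorname{pr}(v)=\{u\in V:u<v\}$. A family of quantum kernels for $\mathcal D$ assigns to every $v\in V$ a positive definite operator $Q_{v|\operatorname{pa}(v)}$ on $\mathcal H_{\{v\}\cup\operatorname{pa}(v)}$ with $\operatorname{Tr}_v(Q_{v|\operatorname{pa}(v)})=I_{\operatorname{pa}(v)}$ (for a root $v$, this is a positive definite density operator $Q_v$ on $\mathcal H_v$). For a topological ordering $v_1<\cdots<v_n$ put $V_j=\{v_1,\dots,v_j\}$, $\omega_{V_1}=Q_{v_1}$ and $\omega_{V_j}=Q_{v_j|\operatorname{pa}(v_j)}\star\omega_{V_{j-1}}$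 for $j=2,\dots,n$ (on $\mathcal H_{V_j}$); $\Phi_{\mathcal D,<}(\mathcal Q):=\omega_{V_n}$. The von Neumann entropy is $\operatorname S(A)_\omega=-\operatorname{Tr}(\omega_A\log\omega_A)$, $\operatorname S(\varnothing)_\omega=0$. For pairwise disjoint $A,B,C\subseteq V$, $I(A:B\mid C)_\omega=\operatorname S(A\cup C)_\omega+\operatorname S(B\cup C)_\omega-\operatorname S(C)_\omega-\operatorname S(A\cup B\cup C)_\omega$, and $A\perp\!\!\!\perp_Q B\mid C$ means $I(A:B\mid C)_\omega=0$. A walk (repeated vertices allowed, arrows traversable in either direction) has a collider at a non-endpoint $\alpha_i$ if $\alpha_{i-1}\to\alpha_i\leftarrow\alpha_{i+1}$. A walk is active relative to $S$ if every non-collider on it is outside $S$ and every collider on it is in $S$; otherwise it is blocked by $S$. Disjoint $A,B$ are $d$-separated by $S$ if every walk from $A$ to $B$ is blocked by $S$. Markov properties of $\omega$: (O), for a topological ordering: $v\perp\!\!\!\perp_Q(\operatorname{pr}(v)\setminus\operatorname{pa}(v))\mid\operatorname{pa}(v)$ for all $v\in V$ (here: for every topological ordering). (L): $v\perp\!\!\!\perp_Q(\operatorname{nd}(v)\setminus\operatorname{pa}(v))\mid\operatorname{pa}(v)$ for all $v\in V$. (G): for all pairwise disjoint $A,B,S\subseteq V$, if $A,B$ are $d$-separated by $S$ then $A\perp\!\!\!\perp_Q B\mid S$. *)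

theory Defs
  imports "Jordan_Normal_Form.Schur_Decomposition" "HOL-Library.Countable_Set" "HOL-Library.FuncSet"
begin

definition mtrace :: "complex mat \<Rightarrow> complex" where
  "mtrace M = (\<Sum>i<dim_row M. M $$ (i, i))"

definition unitary_mat :: "nat \<Rightarrow> complex mat \<Rightarrow> bool" where
  "unitary_mat n U \<longleftrightarrow>
     U \<in> carrier_mat n n \<and> U * mat_adjoint U = 1\<^sub>m n \<and> mat_adjoint U * U = 1\<^sub>m n"

definition pos_def :: "nat \<Rightarrow> complex mat \<Rightarrow> bool" where
  "pos_def n M \<longleftrightarrow> M \<in> carrier_mat n n \<and> mat_adjoint M = M \<and>
     (\<forall>x \<in> carrier_vec n. x \<noteq> 0\<^sub>v n \<longrightarrow> 0 < Re ((M *\<^sub>v x) \<bullet>c x))"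

text \<open>
  Functional calculus of a Hermitian matrix: if \<open>M = U diag(l) U*\<close> with \<open>U\<close> unitary
  and \<open>l\<close> real, then \<open>f(M) = U diag(f \<circ> l) U*\<close>, which does not depend on the diagonalization.
  The value is meaningful for Hermitian \<open>M\<close> only.
\<close>
definition spectral_fun :: "(real \<Rightarrow> real) \<Rightarrow> complex mat \<Rightarrow> complex mat" where
  "spectral_fun f M = (THE N. \<exists>U l. unitary_mat (dim_row M) U \<and>
     M = U * mat_diag (dim_row M) (\<lambda>i. complex_of_real (l i)) * mat_adjoint U \<and>
     N = U * mat_diag (dim_row M) (\<lambda>i. complex_of_real (f (l i))) * mat_adjoint U)"

definition star :: "complex mat \<Rightarrow> complex mat \<Rightarrow> complex mat" (infixr "\<star>" 70) where
  "M \<star> N = spectral_fun sqrt N * M * spectral_fun sqrt N"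

text \<open>
  \<open>\<H>\<^sub>v\<close> is \<open>\<complex>\<close> to the power \<open>d v\<close>, i.e. it comes with an orthonormal basis indexed by
  \<open>{..<d v}\<close>. The product basis of \<open>\<H>\<^sub>A\<close> is indexed by the configurations
  on \<open>A\<close>. Operators on \<open>\<H>\<^sub>A\<close> are square matrices of size \<open>hdim d A\<close>, whose rows and columns are
  numbered by the library bijection \<^const>\<open>to_nat_on\<close> from the configurations to
  \<open>{..<hdim d A}\<close>. The empty set has exactly one configuration, so \<open>\<H>\<close> of the empty set is
  the scalar field.
\<close>
definition configs :: "('v \<Rightarrow> nat) \<Rightarrow> 'v set \<Rightarrow> ('v \<Rightarrow> nat) set" where
  "configs d A = (\<Pi>\<^sub>E v\<in>A. {..<d v})"

definition hdim :: "('v \<Rightarrow> nat) \<Rightarrow> 'v set \<Rightarrow> nat" where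
  "hdim d A = card (configs d A)"

definition entry :: "('v \<Rightarrow> nat) \<Rightarrow> 'v set \<Rightarrow> complex mat \<Rightarrow> ('v \<Rightarrow> nat) \<Rightarrow> ('v \<Rightarrow> nat) \<Rightarrow> complex" where
  "entry d A M x y = M $$ (to_nat_on (configs d A) x, to_nat_on (configs d A) y)"

definition op_of :: "('v \<Rightarrow> nat) \<Rightarrow> 'v set \<Rightarrow> (('v \<Rightarrow> nat) \<Rightarrow> ('v \<Rightarrow> nat) \<Rightarrow> complex) \<Rightarrow> complex mat" where
  "op_of d A f = mat (hdim d A) (hdim d A)
     (\<lambda>(i, j). f (from_nat_into (configs d A) i) (from_nat_into (configs d A) j))"

text \<open>For \<open>A \<subseteq> B\<close>: the operator \<open>M \<otimes> I\<close> on \<open>\<H>\<^sub>B\<close>, the identity being on \<open>\<H>\<close> of \<open>B - A\<close>.\<close>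
definition embed_op :: "('v \<Rightarrow> nat) \<Rightarrow> 'v set \<Rightarrow> 'v set \<Rightarrow> complex mat \<Rightarrow> complex mat" where
  "embed_op d A B M = op_of d B (\<lambda>x y.
     if \<forall>v\<in>B - A. x v = y v then entry d A M (restrict x A) (restrict y A) else 0)"

text \<open>For \<open>A \<subseteq> B\<close>: the partial trace over \<open>B - A\<close> of an operator on \<open>\<H>\<^sub>B\<close>.\<close>
definition ptrace :: "('v \<Rightarrow> nat) \<Rightarrow> 'v set \<Rightarrow> 'v set \<Rightarrow> complex mat \<Rightarrow> complex mat" where
  "ptrace d B A M = op_of d A (\<lambda>x y.
     \<Sum>z\<in>configs d (B - A). entry d B M (override_on z x A) (override_on z y A))"

definition pd_state :: "('v \<Rightarrow> nat) \<Rightarrow> 'v set \<Rightarrow> complex mat \<Rightarrow> bool" where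
  "pd_state d V \<omega> \<longleftrightarrow> pos_def (hdim d V) \<omega> \<and> mtrace \<omega> = 1"

text \<open>In the following, \<open>\<omega>\<close> is a state on \<open>\<H>\<^sub>V\<close>; \<open>cond_op d V \<omega> A B\<close> is the operator
  \<open>\<omega>\<close> of \<open>A|B\<close>, acting on \<open>\<H>\<close> of \<open>A \<union> B\<close>.\<close>
definition marg :: "('v \<Rightarrow> nat) \<Rightarrow> 'v set \<Rightarrow> complex mat \<Rightarrow> 'v set \<Rightarrow> complex mat" where
  "marg d V \<omega> A = ptrace d V A \<omega>"

definition cond_op :: "('v \<Rightarrow> nat) \<Rightarrow> 'v set \<Rightarrow> complex mat \<Rightarrow> 'v set \<Rightarrow> 'v set \<Rightarrow> complex mat" where
  "cond_op d V \<omega> A B =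
     (let R = embed_op d B (A \<union> B) (spectral_fun (\<lambda>x. 1 / sqrt x) (marg d V \<omega> B))
      in R * marg d V \<omega> (A \<union> B) * R)"

definition entropy :: "('v \<Rightarrow> nat) \<Rightarrow> 'v set \<Rightarrow> complex mat \<Rightarrow> 'v set \<Rightarrow> real" where
  "entropy d V \<omega> A =
     (if A = {} then 0 else - Re (mtrace (marg d V \<omega> A * spectral_fun ln (marg d V \<omega> A))))"

definition cond_mutual_info ::
  "('v \<Rightarrow> nat) \<Rightarrow> 'v set \<Rightarrow> complex mat \<Rightarrow> 'v set \<Rightarrow> 'v set \<Rightarrow> 'v set \<Rightarrow> real" where
  "cond_mutual_info d V \<omega> A B C =
     entropy d V \<omega> (A \<union> C) + entropy d V \<omega> (B \<union> C) - entropy d V \<omega> C - entropy d V \<omega> (A \<union> B \<union> C)"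

definition q_indep ::
  "('v \<Rightarrow> nat) \<Rightarrow> 'v set \<Rightarrow> complex mat \<Rightarrow> 'v set \<Rightarrow> 'v set \<Rightarrow> 'v set \<Rightarrow> bool" where
  "q_indep d V \<omega> A B C \<longleftrightarrow> cond_mutual_info d V \<omega> A B C = 0"

definition dag :: "'v set \<Rightarrow> ('v \<times> 'v) set \<Rightarrow> bool" where
  "dag V E \<longleftrightarrow> finite V \<and> E \<subseteq> V \<times> V \<and> acyclic E"

definition pa :: "('v \<times> 'v) set \<Rightarrow> 'v \<Rightarrow> 'v set" where
  "pa E v = {u. (u, v) \<in> E}"

definition de :: "('v \<times> 'v) set \<Rightarrow> 'v \<Rightarrow> 'v set" where
  "de E v = {w. (v, w) \<in> E\<^sup>+}"

definition nd :: "'v set \<Rightarrow> ('v \<times> 'v) set \<Rightarrow> 'v \<Rightarrow> 'v set" where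
  "nd V E v = V - ({v} \<union> de E v)"

definition topological_ordering :: "'v set \<Rightarrow> ('v \<times> 'v) set \<Rightarrow> ('v \<times> 'v) set \<Rightarrow> bool" where
  "topological_ordering V E r \<longleftrightarrow> r \<subseteq> V \<times> V \<and> strict_linear_order_on V r \<and> E \<subseteq> r"

definition pr :: "'v set \<Rightarrow> ('v \<times> 'v) set \<Rightarrow> 'v \<Rightarrow> 'v set" where
  "pr V r v = {u \<in> V. (u, v) \<in> r}"

definition enumeration :: "'v set \<Rightarrow> ('v \<times> 'v) set \<Rightarrow> 'v list" where
  "enumeration V r =
     (THE vs. distinct vs \<and> set vs = V \<and> sorted_wrt (\<lambda>u w. (u, w) \<in> r) vs)"

definition walk :: "'v set \<Rightarrow> ('v \<times> 'v) set \<Rightarrow> 'v list \<Rightarrow> bool" where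
  "walk V E p \<longleftrightarrow> p \<noteq> [] \<and> set p \<subseteq> V \<and>
     (\<forall>i. Suc i < length p \<longrightarrow> (p ! i, p ! Suc i) \<in> E \<or> (p ! Suc i, p ! i) \<in> E)"

text \<open>Position \<open>i\<close> of the walk, since the same vertex may occur as a collider and as a
  non-collider. Endpoints are non-colliders.\<close>
definition collider_at :: "('v \<times> 'v) set \<Rightarrow> 'v list \<Rightarrow> nat \<Rightarrow> bool" where
  "collider_at E p i \<longleftrightarrow> 0 < i \<and> Suc i < length p \<and>
     (p ! (i - 1), p ! i) \<in> E \<and> (p ! Suc i, p ! i) \<in> E"

definition active :: "('v \<times> 'v) set \<Rightarrow> 'v list \<Rightarrow> 'v set \<Rightarrow> bool" where
  "active E p S \<longleftrightarrow>
     (\<forall>i < length p. if collider_at E p i then p ! i \<in> S else p ! i \<notin> S)"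

definition d_separated :: "'v set \<Rightarrow> ('v \<times> 'v) set \<Rightarrow> 'v set \<Rightarrow> 'v set \<Rightarrow> 'v set \<Rightarrow> bool" where
  "d_separated V E A B S \<longleftrightarrow>
     (\<forall>p. walk V E p \<and> hd p \<in> A \<and> last p \<in> B \<longrightarrow> \<not> active E p S)"

definition ordered_markov ::
  "('v \<Rightarrow> nat) \<Rightarrow> 'v set \<Rightarrow> ('v \<times> 'v) set \<Rightarrow> ('v \<times> 'v) set \<Rightarrow> complex mat \<Rightarrow> bool" where
  "ordered_markov d V E r \<omega> \<longleftrightarrow>
     (\<forall>v\<in>V. q_indep d V \<omega> {v} (pr V r v - pa E v) (pa E v))"

definition local_markov :: "('v \<Rightarrow> nat) \<Rightarrow> 'v set \<Rightarrow> ('v \<times> 'v) set \<Rightarrow> complex mat \<Rightarrow> bool" where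
  "local_markov d V E \<omega> \<longleftrightarrow>
     (\<forall>v\<in>V. q_indep d V \<omega> {v} (nd V E v - pa E v) (pa E v))"

definition global_markov :: "('v \<Rightarrow> nat) \<Rightarrow> 'v set \<Rightarrow> ('v \<times> 'v) set \<Rightarrow> complex mat \<Rightarrow> bool" where
  "global_markov d V E \<omega> \<longleftrightarrow>
     (\<forall>A B S. A \<subseteq> V \<and> B \<subseteq> V \<and> S \<subseteq> V \<and> A \<inter> B = {} \<and> A \<inter> S = {} \<and> B \<inter> S = {} \<and>
        d_separated V E A B S \<longrightarrow> q_indep d V \<omega> A B S)"

abbreviation family :: "('v \<times> 'v) set \<Rightarrow> 'v \<Rightarrow> 'v set" where
  "family E v \<equiv> {v} \<union> pa E v"

definition quantum_kernels ::
  "('v \<Rightarrow> nat) \<Rightarrow> 'v set \<Rightarrow> ('v \<times> 'v) set \<Rightarrow> ('v \<Rightarrow> complex mat) \<Rightarrow> bool" where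
  "quantum_kernels d V E Q \<longleftrightarrow>
     (\<forall>v\<in>V. pos_def (hdim d (family E v)) (Q v) \<and>
        ptrace d (family E v) (pa E v) (Q v) = 1\<^sub>m (hdim d (pa E v)))"

text \<open>
  For a list \<open>vs\<close> enumerating \<open>v\<^sub>1, v\<^sub>2, \<dots>\<close>, the operator
  \<open>K v\<^sub>j \<star> (K v\<^sub>j\<^sub>-\<^sub>1 \<star> \<dots> \<star> (K v\<^sub>2 \<star> X))\<close> on the tensor product over \<open>v\<^sub>1, \<dots>, v\<^sub>j\<close>, where
  \<open>K v\<close> acts on the family of \<open>v\<close> and \<open>X\<close> on \<open>\<H>\<close> of \<open>v\<^sub>1\<close>. For \<open>j = 0\<close> it is the scalar 1,
  which matters for the empty graph only.
\<close>
fun star_chain ::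
  "('v \<Rightarrow> nat) \<Rightarrow> ('v \<times> 'v) set \<Rightarrow> ('v \<Rightarrow> complex mat) \<Rightarrow> complex mat \<Rightarrow> 'v list \<Rightarrow> nat \<Rightarrow> complex mat" where
  "star_chain d E K X vs 0 = 1\<^sub>m (hdim d {})"
| "star_chain d E K X vs (Suc 0) = X"
| "star_chain d E K X vs (Suc (Suc j)) =
     embed_op d (family E (vs ! Suc j)) (set (take (Suc (Suc j)) vs)) (K (vs ! Suc j)) \<star>
     embed_op d (set (take (Suc j) vs)) (set (take (Suc (Suc j)) vs)) (star_chain d E K X vs (Suc j))"

definition kernel_state ::
  "('v \<Rightarrow> nat) \<Rightarrow> 'v set \<Rightarrow> ('v \<times> 'v) set \<Rightarrow> ('v \<times> 'v) set \<Rightarrow> ('v \<Rightarrow> complex mat) \<Rightarrow> complex mat" where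
  "kernel_state d V E r Q =
     (let vs = enumeration V r in star_chain d E Q (Q (vs ! 0)) vs (card V))"

definition intrinsic_factorization ::
  "('v \<Rightarrow> nat) \<Rightarrow> 'v set \<Rightarrow> ('v \<times> 'v) set \<Rightarrow> ('v \<times> 'v) set \<Rightarrow> complex mat \<Rightarrow> complex mat" where
  "intrinsic_factorization d V E r \<omega> =
     (let vs = enumeration V r
      in star_chain d E (\<lambda>v. cond_op d V \<omega> {v} (pa E v)) (marg d V \<omega> {vs ! 0}) vs (card V))"

definition kernel_product ::
  "('v \<Rightarrow> nat) \<Rightarrow> 'v set \<Rightarrow> ('v \<times> 'v) set \<Rightarrow> ('v \<Rightarrow> complex mat) \<Rightarrow> 'v list \<Rightarrow> complex mat" where
  "kernel_product d V E Q us =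
     foldr (\<lambda>u M. embed_op d (family E u) V (Q u) * M) us (1\<^sub>m (hdim d V))"

end

(*
  Because the kernels commute, every star product is an ordinary product, and tracing out a sink
  removes exactly its kernel; so the marginal of the state on an ancestral set W is the product of
  the kernels of W. This gives the kernels as conditionals: the product of the kernels of the
  non-descendants of v, reduced to pa(v), commutes with the kernel of v and is cancelled by the two
  inverse square roots.

  For the Markov properties no entropy inequality is needed. If W is ancestral and covered by C and
  D such that every family inside W lies in C or in D, then the marginal on W is a commuting product
  of positive definite F on C and G on D. For T between the intersection S of C and D and W, the
  marginal on T is the commuting product of the reductions of F and G, so its logarithm is the sum
  of their logarithms, and the terms of I(A:B|S) cancel in pairs. d-separation provides such a
  cover: C consists of S and the vertices that an active walk from A can reach.
*)
theory Submission
  imports Defs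
begin

section \<open>Hermitian matrices and functional calculus\<close>

text \<open>Two obstacles shape the development. First, the kernels are only assumed to commute
  after embedding into all of \<open>V\<close>, whereas marginals live on smaller sets. For the
  kernels commutation descends, because embedding is an injective homomorphism once every factor has
  positive dimension. Partial traces do not preserve commutation in general, so a product is reduced
  in both orders and the two results are compared. Second, \<open>spectral_fun\<close> is a definite
  description, and roots and logarithms must pass through commutation relations. One fact does this:
  if \<open>M X = X N\<close>, then \<open>f(M) X = X f(N)\<close>, since in eigenbases
  \<open>X\<close> only links equal eigenvalues. The choices \<open>X = 1\<close>,
  \<open>N = M\<close> and \<open>N\<close> scalar give well-definedness, commutation with
  \<open>f(M)\<close> and the action on eigenvectors. The cover for d-separation works because, in
  the ancestral closure of \<open>A\<close>, \<open>B\<close> and \<open>S\<close>, the vertices of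
  a family outside \<open>S\<close> are all reachable or all unreachable: separation in the moral
  graph, obtained directly from walks.\<close>

lemma mat_adjoint_eq:
  "mat_adjoint (A :: complex mat) = mat (dim_col A) (dim_row A) (\<lambda>(i, j). cnj (A $$ (j, i)))"
  unfolding mat_adjoint_def by (rule eq_matI) (auto simp: mat_of_rows_index)

lemma sq_mult_carrier [simp, intro]:
  "A \<in> carrier_mat n n \<Longrightarrow> B \<in> carrier_mat n n \<Longrightarrow> A * B \<in> carrier_mat n n"
  by (rule mult_carrier_mat)

lemma sq_one [simp]:
  "(A :: complex mat) \<in> carrier_mat n n \<Longrightarrow> A * 1\<^sub>m n = A"
  "(A :: complex mat) \<in> carrier_mat n n \<Longrightarrow> 1\<^sub>m n * A = A"
  by simp_all

lemma adjoint_carrier [simp, intro]: "A \<in> carrier_mat n m \<Longrightarrow> mat_adjoint (A :: complex mat) \<in> carrier_mat m n"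
  by (auto simp: mat_adjoint_eq)

lemma index_adjoint:
  "A \<in> carrier_mat n m \<Longrightarrow> i < m \<Longrightarrow> j < n \<Longrightarrow> mat_adjoint (A :: complex mat) $$ (i, j) = cnj (A $$ (j, i))"
  by (auto simp: mat_adjoint_eq)

lemma adjoint_adjoint [simp]: "mat_adjoint (mat_adjoint A) = (A :: complex mat)"
  by (rule eq_matI) (auto simp: mat_adjoint_eq)

lemma index_mult_sum:
  assumes "A \<in> carrier_mat n m" "B \<in> carrier_mat m k" "i < n" "j < k"
  shows "(A * B) $$ (i, j) = (\<Sum>l<m. A $$ (i, l) * B $$ (l, j))"
  using assms by (auto simp: scalar_prod_def atLeast0LessThan)

lemma adjoint_mult:
  assumes "A \<in> carrier_mat n m" "B \<in> carrier_mat m k"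
  shows "mat_adjoint (A * B) = mat_adjoint B * mat_adjoint (A :: complex mat)"
proof (rule eq_matI)
  fix i j assume "i < dim_row (mat_adjoint B * mat_adjoint A)" "j < dim_col (mat_adjoint B * mat_adjoint A)"
  then have ij: "i < k" "j < n" using assms by (auto simp: mat_adjoint_eq)
  have "A * B \<in> carrier_mat n k" using assms by auto
  then have "mat_adjoint (A * B) $$ (i, j) = cnj ((A * B) $$ (j, i))"
    using ij by (rule index_adjoint)
  also have "\<dots> = (\<Sum>l<m. cnj (A $$ (j, l)) * cnj (B $$ (l, i)))"
    by (simp add: index_mult_sum[OF assms ij(2,1)])
  also have "\<dots> = (\<Sum>l<m. mat_adjoint B $$ (i, l) * mat_adjoint A $$ (l, j))"
    using assms ij by (intro sum.cong) (auto simp: index_adjoint)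
  also have "\<dots> = (mat_adjoint B * mat_adjoint A) $$ (i, j)"
    by (rule index_mult_sum[symmetric]) (use assms ij in auto)
  finally show "mat_adjoint (A * B) $$ (i, j) = (mat_adjoint B * mat_adjoint A) $$ (i, j)" .
qed (use assms in \<open>auto simp: mat_adjoint_eq\<close>)

lemma adjoint_one [simp]: "mat_adjoint (1\<^sub>m n :: complex mat) = 1\<^sub>m n"
  by (rule eq_matI) (auto simp: mat_adjoint_eq)

section \<open>Real diagonal matrices and unitary matrices\<close>

definition real_diag :: "nat \<Rightarrow> (nat \<Rightarrow> real) \<Rightarrow> complex mat" where
  "real_diag n l = mat_diag n (\<lambda>i. complex_of_real (l i))"

lemma real_diag_carrier [simp, intro]: "real_diag n l \<in> carrier_mat n n"
  by (auto simp: real_diag_def)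

lemma dim_real_diag [simp]: "dim_row (real_diag n l) = n" "dim_col (real_diag n l) = n"
  by (auto simp: real_diag_def mat_diag_def)

lemma index_real_diag: "i < n \<Longrightarrow> j < n \<Longrightarrow> real_diag n l $$ (i, j) = (if i = j then of_real (l i) else 0)"
  by (auto simp: real_diag_def mat_diag_def)

lemma real_diag_mult_left:
  "A \<in> carrier_mat n m \<Longrightarrow> real_diag n l * A = mat n m (\<lambda>(i, j). of_real (l i) * A $$ (i, j))"
  unfolding real_diag_def by (rule mat_diag_mult_left)

lemma real_diag_mult_right:
  "A \<in> carrier_mat n m \<Longrightarrow> A * real_diag m l = mat n m (\<lambda>(i, j). A $$ (i, j) * of_real (l j))"
  unfolding real_diag_def by (rule mat_diag_mult_right)

lemma real_diag_mult: "real_diag n l * real_diag n k = real_diag n (\<lambda>i. l i * k i)"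
  by (rule eq_matI) (auto simp: real_diag_mult_left[where m = n] index_real_diag simp del: index_mult_mat(1))

lemma adjoint_real_diag [simp]: "mat_adjoint (real_diag n l) = real_diag n l"
  by (rule eq_matI) (auto simp: mat_adjoint_eq real_diag_def mat_diag_def)

lemma sq_assoc:
  "A \<in> carrier_mat n n \<Longrightarrow> B \<in> carrier_mat n n \<Longrightarrow> C \<in> carrier_mat n n \<Longrightarrow> (A * B) * C = A * (B * C)"
  by (rule assoc_mult_mat)

lemma unitary_matD:
  assumes "unitary_mat n U"
  shows "U \<in> carrier_mat n n" "mat_adjoint U \<in> carrier_mat n n"
    "U * mat_adjoint U = 1\<^sub>m n" "mat_adjoint U * U = 1\<^sub>m n"
  using assms unfolding unitary_mat_def by auto

text \<open>A one-sided inverse of a square matrix is two-sided.\<close>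

lemma unitary_matI:
  assumes "U \<in> carrier_mat n n" "mat_adjoint U * U = 1\<^sub>m n"
  shows "unitary_mat n U"
  using assms mat_mult_left_right_inverse[of "mat_adjoint U" n U] unfolding unitary_mat_def by auto

lemma unitary_cancel:
  assumes "unitary_mat n U" "A \<in> carrier_mat n m"
  shows "U * (mat_adjoint U * A) = A" "mat_adjoint U * (U * A) = A"
  using unitary_matD[OF assms(1)] assms(2)
  by (simp_all add: assoc_mult_mat[symmetric, where ?n\<^sub>1.0 = n and ?n\<^sub>2.0 = n and ?n\<^sub>3.0 = n and ?n\<^sub>4.0 = m])

lemma unitary_mult:
  assumes "unitary_mat n U" "unitary_mat n W"
  shows "unitary_mat n (U * W)"
proof (rule unitary_matI)
  note U = unitary_matD[OF assms(1)] and W = unitary_matD[OF assms(2)]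
  show "mat_adjoint (U * W) * (U * W) = 1\<^sub>m n"
    using U W by (simp add: adjoint_mult[where n = n and m = n and k = n] sq_assoc[of _ n]
        unitary_cancel[OF assms(1), of _ n])
qed (use assms in \<open>auto simp: unitary_mat_def\<close>)

section \<open>Spectral theorem, splitting off one-dimensional diagonal blocks
  (\<open>bordered\<close>)\<close>

definition bordered :: "nat \<Rightarrow> complex \<Rightarrow> complex mat \<Rightarrow> complex mat" where
  "bordered n c P = mat (Suc n) (Suc n) (\<lambda>(i, j). case i of
     0 \<Rightarrow> (case j of 0 \<Rightarrow> c | Suc j' \<Rightarrow> 0) |
     Suc i' \<Rightarrow> (case j of 0 \<Rightarrow> 0 | Suc j' \<Rightarrow> P $$ (i', j')))"

lemma bordered_carrier [simp, intro]: "bordered n c P \<in> carrier_mat (Suc n) (Suc n)"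
  by (simp add: bordered_def)

lemma index_bordered:
  "bordered n c P $$ (0, 0) = c"
  "j < n \<Longrightarrow> bordered n c P $$ (0, Suc j) = 0"
  "i < n \<Longrightarrow> bordered n c P $$ (Suc i, 0) = 0"
  "i < n \<Longrightarrow> j < n \<Longrightarrow> bordered n c P $$ (Suc i, Suc j) = P $$ (i, j)"
  by (simp_all add: bordered_def)

lemma bordered_mult:
  assumes "P \<in> carrier_mat n n" "R \<in> carrier_mat n n"
  shows "bordered n a P * bordered n b R = bordered n (a * b) (P * R)"
proof (rule eq_matI)
  fix i j assume "i < dim_row (bordered n (a * b) (P * R))" "j < dim_col (bordered n (a * b) (P * R))"
  then have ij: "i < Suc n" "j < Suc n" by (auto simp: bordered_def)
  have "(bordered n a P * bordered n b R) $$ (i, j)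
      = (\<Sum>l<Suc n. bordered n a P $$ (i, l) * bordered n b R $$ (l, j))"
    by (rule index_mult_sum) (use ij in auto)
  also have "\<dots> = bordered n a P $$ (i, 0) * bordered n b R $$ (0, j)
      + (\<Sum>l<n. bordered n a P $$ (i, Suc l) * bordered n b R $$ (Suc l, j))"
    by (rule sum.lessThan_Suc_shift)
  also have "\<dots> = bordered n (a * b) (P * R) $$ (i, j)"
    using ij assms
    by (cases i; cases j) (simp_all add: index_bordered index_mult_sum[OF assms] del: index_mult_mat)
  finally show "(bordered n a P * bordered n b R) $$ (i, j) = bordered n (a * b) (P * R) $$ (i, j)" .
qed (auto simp: bordered_def)

lemma adjoint_bordered:
  assumes "P \<in> carrier_mat n n"
  shows "mat_adjoint (bordered n c P) = bordered n (cnj c) (mat_adjoint P)"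
  using assms by (intro eq_matI) (auto simp: mat_adjoint_eq bordered_def split: nat.splits)

lemma bordered_one: "bordered n 1 (1\<^sub>m n) = 1\<^sub>m (Suc n)"
  by (intro eq_matI) (auto simp: bordered_def split: nat.splits)

lemma bordered_real_diag:
  "bordered n (of_real e) (real_diag n l) = real_diag (Suc n) (case_nat e l)"
  by (intro eq_matI) (auto simp: bordered_def real_diag_def mat_diag_def split: nat.splits)

lemma bordered_unitary: "unitary_mat n P \<Longrightarrow> unitary_mat (Suc n) (bordered n 1 P)"
  by (rule unitary_matI) (auto simp: adjoint_bordered bordered_mult bordered_one unitary_mat_def)

text \<open>The characteristic polynomial has a complex root. An eigenvector for it is completed to
  a basis with itself in front; Gram-Schmidt keeps the first vector, which becomes column 0 after
  normalization.\<close>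

lemma ex_unitary_eigenvector:
  assumes A: "A \<in> carrier_mat (Suc n) (Suc n)"
  shows "\<exists>U e. unitary_mat (Suc n) U \<and> A *\<^sub>v col U 0 = e \<cdot>\<^sub>v col U 0"
proof -
  let ?n = "Suc n"
  have "\<not> constant (poly (char_poly A))"
    using degree_monic_char_poly[OF A] by (simp add: constant_degree)
  then obtain e where "poly (char_poly A) e = 0"
    using fundamental_theorem_of_algebra by blast
  then have "eigenvalue A e" using eigenvalue_root_char_poly[OF A] by simp
  then obtain v where v: "v \<in> carrier_vec ?n" "v \<noteq> 0\<^sub>v ?n" and Av: "A *\<^sub>v v = e \<cdot>\<^sub>v v"
    using A unfolding eigenvalue_def eigenvector_def by auto
  interpret cof_vec_space ?n "TYPE(complex)" .
  define b where "b = basis_completion v"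
  define ws where "ws = gram_schmidt ?n b"
  note bc = basis_completion[OF v, folded b_def]
  from bc obtain vs where bv: "b = v # vs" by (cases b) auto
  from gram_schmidt_result[OF bc(2,4,5) refl, folded ws_def] bc(6)
  have ws: "set ws \<subseteq> carrier_vec ?n" "corthogonal ws" "length ws = ?n" by auto
  from gram_schmidt_hd[OF v(1), of vs, folded bv] have "hd ws = v" unfolding ws_def .
  then have ws0: "ws ! 0 = v" using ws(3) by (cases ws) auto
  \<comment> \<open>\<open>gram_schmidt\<close> gives orthogonal vectors of arbitrary length;
    \<open>s j\<close> is the norm of the \<open>j\<close>-th.\<close>
  define s where "s j = complex_of_real (sqrt (Re (ws ! j \<bullet>c ws ! j)))" for j
  define U where "U = mat ?n ?n (\<lambda>(i, j). ws ! j $ i / s j)"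
  have U: "U \<in> carrier_mat ?n ?n" by (simp add: U_def)
  have wsc: "ws ! j \<in> carrier_vec ?n" if "j < ?n" for j using ws that by auto
  have s2: "s j * s j = ws ! j \<bullet>c ws ! j" and s0: "s j \<noteq> 0" if j: "j < ?n" for j
  proof -
    have "ws ! j \<bullet>c ws ! j \<noteq> 0" using corthogonalD[OF ws(2), of j j] ws(3) j by auto
    moreover have "0 \<le> ws ! j \<bullet>c ws ! j" using conjugate_square_ge_0_vec[of "ws ! j"] .
    ultimately have *: "0 < Re (ws ! j \<bullet>c ws ! j)" "ws ! j \<bullet>c ws ! j = complex_of_real (Re (ws ! j \<bullet>c ws ! j))"
      by (auto simp: less_eq_complex_def complex_eq_iff)
    show "s j * s j = ws ! j \<bullet>c ws ! j"
      using * by (simp add: s_def complex_eq_iff)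
    show "s j \<noteq> 0" using *(1) by (simp add: s_def)
  qed
  have "unitary_mat ?n U"
  proof (rule unitary_matI[OF U], rule eq_matI)
    fix i j assume "i < dim_row (1\<^sub>m ?n :: complex mat)" "j < dim_col (1\<^sub>m ?n :: complex mat)"
    then have ij: "i < ?n" "j < ?n" by auto
    have "(mat_adjoint U * U) $$ (i, j) = (\<Sum>k<?n. mat_adjoint U $$ (i, k) * U $$ (k, j))"
      by (rule index_mult_sum) (use U ij in auto)
    also have "\<dots> = (\<Sum>k<?n. ws ! j $ k * cnj (ws ! i $ k) / (s i * s j))"
      using ij by (intro sum.cong) (auto simp: index_adjoint[OF U], auto simp: U_def s_def)
    also have "\<dots> = (ws ! j \<bullet>c ws ! i) / (s i * s j)"
      using wsc[OF ij(1)] wsc[OF ij(2)]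
      by (simp add: scalar_prod_def sum_divide_distrib add_divide_distrib atLeast0LessThan)
    also have "\<dots> = (if i = j then 1 else 0)"
      using corthogonalD[OF ws(2), of j i] ws(3) ij s2[OF ij(1)] s0[OF ij(1)] by auto
    finally show "(mat_adjoint U * U) $$ (i, j) = 1\<^sub>m ?n $$ (i, j)" using ij by simp
  qed (use U in \<open>auto simp: mat_adjoint_eq\<close>)
  moreover have "A *\<^sub>v col U 0 = e \<cdot>\<^sub>v col U 0"
  proof -
    have c: "col U 0 = (1 / s 0) \<cdot>\<^sub>v v"
      using v(1) by (intro eq_vecI) (auto simp: U_def ws0)
    show ?thesis unfolding c using A v Av
      by (simp add: mult_mat_vec smult_smult_assoc mult.commute)
  qed
  ultimately show ?thesis by blast
qed

text \<open>Induction on the size. In a basis with an eigenvector in front, column 0 is a multiple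
  of the first unit vector; self-adjointness then clears row 0 and makes the eigenvalue real, so the
  induction hypothesis applies to the remaining block.\<close>

lemma hermitian_diagonalizable:
  assumes "A \<in> carrier_mat n n" "mat_adjoint A = A"
  shows "\<exists>U l. unitary_mat n U \<and> A = U * real_diag n l * mat_adjoint U"
  using assms
proof (induction n arbitrary: A)
  case 0
  then have "unitary_mat 0 (1\<^sub>m 0) \<and> A = 1\<^sub>m 0 * real_diag 0 (\<lambda>_. 0) * mat_adjoint (1\<^sub>m 0)"
    by (auto simp: unitary_mat_def)
  then show ?case by blast
next
  case (Suc n)
  let ?n = "Suc n"
  note A = Suc.prems(1) and herm = Suc.prems(2)
  from ex_unitary_eigenvector[OF A] obtain U e where
    unit: "unitary_mat ?n U" and ev: "A *\<^sub>v col U 0 = e \<cdot>\<^sub>v col U 0" by blast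
  note U = unitary_matD[OF unit]
  define B where "B = mat_adjoint U * A * U"
  have B: "B \<in> carrier_mat ?n ?n" using U A by (auto simp: B_def)
  have hB: "mat_adjoint B = B"
    using U A by (simp add: B_def adjoint_mult[where n = ?n and m = ?n and k = ?n] herm sq_assoc[of _ ?n])
  have AB: "A = U * B * mat_adjoint U"
    using U A by (simp add: B_def sq_assoc[of _ ?n] unitary_cancel[OF unit, of _ ?n])
  have B0: "B $$ (i, 0) = (if i = 0 then e else 0)" if i: "i < ?n" for i
  proof -
    have AU: "(A * U) $$ (k, 0) = e * U $$ (k, 0)" if "k < ?n" for k
    proof -
      have "(A * U) $$ (k, 0) = (A *\<^sub>v col U 0) $ k" using A U that by auto
      also have "\<dots> = e * U $$ (k, 0)" using U that by (simp add: ev)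
      finally show ?thesis .
    qed
    have "B $$ (i, 0) = (mat_adjoint U * (A * U)) $$ (i, 0)"
      using U A by (simp add: B_def sq_assoc[of _ ?n])
    also have "\<dots> = (\<Sum>k<?n. mat_adjoint U $$ (i, k) * (A * U) $$ (k, 0))"
      by (rule index_mult_sum[where n = ?n and k = ?n]) (use U A i in auto)
    also have "\<dots> = e * (\<Sum>k<?n. mat_adjoint U $$ (i, k) * U $$ (k, 0))"
      unfolding sum_distrib_left by (rule sum.cong) (auto simp: AU)
    also have "(\<Sum>k<?n. mat_adjoint U $$ (i, k) * U $$ (k, 0)) = (mat_adjoint U * U) $$ (i, 0)"
      by (rule index_mult_sum[symmetric]) (use U i in auto)
    finally show ?thesis using U i by simp
  qed
  have Bsym: "B $$ (i, j) = cnj (B $$ (j, i))" if "i < ?n" "j < ?n" for i j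
    using index_adjoint[OF B that] hB by simp
  have e: "e = of_real (Re e)"
    using Bsym[of 0 0] B0[of 0] by (simp add: complex_eq_iff)
  define C where "C = mat n n (\<lambda>(i, j). B $$ (Suc i, Suc j))"
  have C: "C \<in> carrier_mat n n" by (simp add: C_def)
  have hC: "mat_adjoint C = C"
    by (rule eq_matI) (auto simp: index_adjoint[OF C] C_def mat_adjoint_eq Bsym[symmetric])
  from Suc.IH[OF C hC] obtain P l where unitP: "unitary_mat n P" and CP: "C = P * real_diag n l * mat_adjoint P"
    by blast
  note P = unitary_matD[OF unitP]
  have BC: "B = bordered n (of_real (Re e)) C"
  proof (rule eq_matI)
    fix i j assume "i < dim_row (bordered n (of_real (Re e)) C)" "j < dim_col (bordered n (of_real (Re e)) C)"
    then have ij: "i < ?n" "j < ?n" by (auto simp: bordered_def)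
    have "B $$ (0, j) = (if j = 0 then e else 0)"
      using Bsym[of 0 j] B0[of j] e ij by (auto simp: complex_eq_iff)
    then show "B $$ (i, j) = bordered n (of_real (Re e)) C $$ (i, j)"
      using ij B0[of i] e by (auto simp: bordered_def C_def split: nat.splits)
  qed (use B in \<open>auto simp: bordered_def\<close>)
  have BP: "B = bordered n 1 P * real_diag ?n (case_nat (Re e) l) * mat_adjoint (bordered n 1 P)"
    using P by (simp add: BC CP adjoint_bordered bordered_mult flip: bordered_real_diag)
  have "A = (U * bordered n 1 P) * real_diag ?n (case_nat (Re e) l) * mat_adjoint (U * bordered n 1 P)"
    unfolding AB BP using U
    by (simp add: adjoint_mult[where n = ?n and m = ?n and k = ?n] sq_assoc[of _ ?n])
  with unitary_mult[OF unit bordered_unitary[OF unitP]] show ?case by blast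
qed

text \<open>Entrywise the hypothesis says \<open>W $$ (i, j) = 0\<close> or
  \<open>l i = k j\<close>, and this survives the application of any \<open>f\<close>.\<close>

lemma real_diag_intertwine:
  assumes W: "W \<in> carrier_mat n m" and eq: "real_diag n l * W = W * real_diag m k"
  shows "real_diag n (\<lambda>i. f (l i)) * W = W * real_diag m (\<lambda>i. f (k i))"
proof (rule eq_matI)
  fix i j assume "i < dim_row (W * real_diag m (\<lambda>i. f (k i)))" "j < dim_col (W * real_diag m (\<lambda>i. f (k i)))"
  then have ij: "i < n" "j < m" using W by auto
  have "of_real (l i) * W $$ (i, j) = W $$ (i, j) * of_real (k j)"
    using arg_cong[OF eq, of "\<lambda>M. M $$ (i, j)"] ij W by (simp add: real_diag_mult_left real_diag_mult_right)
  then have "W $$ (i, j) = 0 \<or> l i = k j" by (simp add: mult.commute)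
  then show "(real_diag n (\<lambda>i. f (l i)) * W) $$ (i, j) = (W * real_diag m (\<lambda>i. f (k i))) $$ (i, j)"
    using ij W by (auto simp: real_diag_mult_left real_diag_mult_right)
qed (use W in auto)

text \<open>In the eigenbases \<open>X\<close> becomes \<open>mat_adjoint U * X * W\<close>, which
  intertwines the two diagonals.\<close>

lemma conj_real_diag_intertwine:
  assumes U: "unitary_mat n U" and W: "unitary_mat m W" and X: "X \<in> carrier_mat n m"
    and eq: "(U * real_diag n l * mat_adjoint U) * X = X * (W * real_diag m k * mat_adjoint W)"
  shows "(U * real_diag n (\<lambda>i. f (l i)) * mat_adjoint U) * X = X * (W * real_diag m (\<lambda>i. f (k i)) * mat_adjoint W)"
proof -
  note U' = unitary_matD[OF U] and W' = unitary_matD[OF W]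
  note as = assoc_mult_mat[where ?n\<^sub>1.0 = n and ?n\<^sub>2.0 = n and ?n\<^sub>3.0 = n and ?n\<^sub>4.0 = m]
    assoc_mult_mat[where ?n\<^sub>1.0 = n and ?n\<^sub>2.0 = n and ?n\<^sub>3.0 = m and ?n\<^sub>4.0 = m]
    assoc_mult_mat[where ?n\<^sub>1.0 = n and ?n\<^sub>2.0 = m and ?n\<^sub>3.0 = m and ?n\<^sub>4.0 = m]
    assoc_mult_mat[where ?n\<^sub>1.0 = n and ?n\<^sub>2.0 = n and ?n\<^sub>3.0 = n and ?n\<^sub>4.0 = n]
    assoc_mult_mat[where ?n\<^sub>1.0 = m and ?n\<^sub>2.0 = m and ?n\<^sub>3.0 = m and ?n\<^sub>4.0 = m]
    mult_carrier_mat[where nr = n and n = n and nc = m] mult_carrier_mat[where nr = n and n = m and nc = m]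
  note cancel = unitary_cancel[OF U, of _ m] unitary_cancel[OF W, of _ m]
  let ?Y = "mat_adjoint U * X * W"
  have Y: "?Y \<in> carrier_mat n m"
    by (rule mult_carrier_mat[OF mult_carrier_mat[OF U'(2) X] W'(1)])
  have "real_diag n l * ?Y = mat_adjoint U * ((U * real_diag n l * mat_adjoint U) * X) * W"
    using U' W' X by (simp add: as cancel)
  also have "\<dots> = ?Y * real_diag m k"
    unfolding eq using U' W' X by (simp add: as cancel)
  finally have Yeq: "real_diag n (\<lambda>i. f (l i)) * ?Y = ?Y * real_diag m (\<lambda>i. f (k i))"
    by (rule real_diag_intertwine[OF Y])
  have "(U * real_diag n (\<lambda>i. f (l i)) * mat_adjoint U) * X
      = U * (real_diag n (\<lambda>i. f (l i)) * ?Y) * mat_adjoint W"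
    using U' W' X by (simp add: as cancel)
  also have "\<dots> = X * (W * real_diag m (\<lambda>i. f (k i)) * mat_adjoint W)"
    unfolding Yeq using U' W' X by (simp add: as cancel)
  finally show ?thesis .
qed

text \<open>Uniqueness for the \<open>THE\<close>: two diagonalizations of \<open>M\<close> are
  intertwined by the identity matrix.\<close>

lemma spectral_fun_eq:
  assumes U: "unitary_mat n U" and M: "M = U * real_diag n l * mat_adjoint U"
  shows "spectral_fun f M = U * real_diag n (\<lambda>i. f (l i)) * mat_adjoint U"
proof -
  have n: "dim_row M = n" using unitary_matD[OF U] M by auto
  show ?thesis unfolding spectral_fun_def n real_diag_def[symmetric]
  proof (rule the_equality)
    fix N assume "\<exists>W k. unitary_mat n W \<and> M = W * real_diag n k * mat_adjoint W \<and>
      N = W * real_diag n (\<lambda>i. f (k i)) * mat_adjoint W"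
    then obtain W k where W: "unitary_mat n W" and MW: "M = W * real_diag n k * mat_adjoint W" and
      N: "N = W * real_diag n (\<lambda>i. f (k i)) * mat_adjoint W" by blast
    note U' = unitary_matD[OF U] and W' = unitary_matD[OF W]
    have Mc: "M \<in> carrier_mat n n" using M U' by auto
    have "(U * real_diag n l * mat_adjoint U) * 1\<^sub>m n = 1\<^sub>m n * (W * real_diag n k * mat_adjoint W)"
      using Mc M MW by simp
    from conj_real_diag_intertwine[OF U W _ this, of f]
    have "(U * real_diag n (\<lambda>i. f (l i)) * mat_adjoint U) * 1\<^sub>m n
      = 1\<^sub>m n * (W * real_diag n (\<lambda>i. f (k i)) * mat_adjoint W)" by simp
    then show "N = U * real_diag n (\<lambda>i. f (l i)) * mat_adjoint U"
      using U' W' N by (simp add: right_mult_one_mat[where nr = n and nc = n] left_mult_one_mat[where nr = n and nc = n])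
  qed (use U M in blast)
qed

section \<open>Rules of the functional calculus for Hermitian matrices\<close>

definition hermitian :: "nat \<Rightarrow> complex mat \<Rightarrow> bool" where
  "hermitian n M \<longleftrightarrow> M \<in> carrier_mat n n \<and> mat_adjoint M = M"

lemma hermitian_obtain:
  assumes "hermitian n M"
  obtains U l where "unitary_mat n U" "M = U * real_diag n l * mat_adjoint U"
  using assms hermitian_diagonalizable unfolding hermitian_def by blast

lemma hermitian_conj_real_diag:
  assumes "unitary_mat n U"
  shows "hermitian n (U * real_diag n l * mat_adjoint U)"
  using unitary_matD[OF assms]
  by (simp add: hermitian_def adjoint_mult[where n = n and m = n and k = n] sq_assoc[of _ n])

lemma hermitian_spectral_fun:
  assumes "hermitian n M" shows "hermitian n (spectral_fun f M)"
  by (rule hermitian_obtain[OF assms]) (simp add: spectral_fun_eq hermitian_conj_real_diag)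

lemma spectral_fun_intertwine:
  assumes M: "hermitian n M" and N: "hermitian m N" and X: "X \<in> carrier_mat n m" and eq: "M * X = X * N"
  shows "spectral_fun f M * X = X * spectral_fun f N"
proof -
  obtain U l where U: "unitary_mat n U" and MU: "M = U * real_diag n l * mat_adjoint U"
    using hermitian_obtain[OF M] .
  obtain W k where W: "unitary_mat m W" and NW: "N = W * real_diag m k * mat_adjoint W"
    using hermitian_obtain[OF N] .
  show ?thesis
    unfolding spectral_fun_eq[OF U MU] spectral_fun_eq[OF W NW]
    by (rule conj_real_diag_intertwine[OF U W X]) (use eq MU NW in simp)
qed

text \<open>An eigenvalue equation for all columns of \<open>X\<close> at once is an intertwining
  relation with a scalar matrix.\<close>

lemma spectral_fun_eigen:
  assumes M: "hermitian n M" and X: "X \<in> carrier_mat n m" and eq: "M * X = of_real a \<cdot>\<^sub>m X"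
  shows "spectral_fun f M * X = of_real (f a) \<cdot>\<^sub>m X"
proof -
  have D: "X * real_diag m (\<lambda>_. b) = of_real b \<cdot>\<^sub>m X" for b
    using X by (intro eq_matI) (auto simp: real_diag_mult_right mult.commute simp del: index_mult_mat(1))
  have u: "unitary_mat m (1\<^sub>m m)" by (simp add: unitary_mat_def)
  have s: "real_diag m l = 1\<^sub>m m * real_diag m l * mat_adjoint (1\<^sub>m m)" for l
    by (simp add: left_mult_one_mat[where nr = m and nc = m] right_mult_one_mat[where nr = m and nc = m])
  have h: "hermitian m (real_diag m (\<lambda>_. a))" by (simp add: hermitian_def)
  show ?thesis
    using spectral_fun_intertwine[OF M h X, of f] eq
    by (simp add: D spectral_fun_eq[OF u s] s[symmetric])
qed

lemma spectral_fun_mult: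
  assumes M: "hermitian n M"
  shows "spectral_fun f M * spectral_fun g M = spectral_fun (\<lambda>x. f x * g x) M"
proof -
  obtain U l where U: "unitary_mat n U" and MU: "M = U * real_diag n l * mat_adjoint U"
    using hermitian_obtain[OF M] .
  show ?thesis
    unfolding spectral_fun_eq[OF U MU] using unitary_matD[OF U]
    by (simp add: sq_assoc[of _ n] unitary_cancel[OF U, of _ n])
      (simp add: sq_assoc[of _ n, symmetric] real_diag_mult)
qed

lemma spectral_fun_id:
  assumes M: "hermitian n M" shows "spectral_fun (\<lambda>x. x) M = M"
proof -
  obtain U l where U: "unitary_mat n U" and MU: "M = U * real_diag n l * mat_adjoint U"
    using hermitian_obtain[OF M] .
  show ?thesis using spectral_fun_eq[OF U MU, of "\<lambda>x. x"] MU by simp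
qed

text \<open>The indicator functions of the eigenvalues give the spectral projections of
  \<open>M\<close>. A matrix annihilated by all of them vanishes on every eigenvector, that is, on
  every column of \<open>U\<close>.\<close>

lemma mult_indicator_spectral_fun_zero:
  assumes U: "unitary_mat n U" and MU: "M = U * real_diag n l * mat_adjoint U"
    and Y: "Y \<in> carrier_mat m n"
    and zero: "\<And>i. i < n \<Longrightarrow> Y * spectral_fun (\<lambda>x. if x = l i then 1 else 0) M = 0\<^sub>m m n"
  shows "Y = 0\<^sub>m m n"
proof -
  note U' = unitary_matD[OF U]
  note as = assoc_mult_mat[where ?n\<^sub>1.0 = m and ?n\<^sub>2.0 = n and ?n\<^sub>3.0 = n and ?n\<^sub>4.0 = n]
  have YU: "Y * U \<in> carrier_mat m n" using Y U' by auto
  have "Y * U = 0\<^sub>m m n"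
  proof (rule eq_matI)
    fix i j assume "i < dim_row (0\<^sub>m m n :: complex mat)" "j < dim_col (0\<^sub>m m n :: complex mat)"
    then have ij: "i < m" "j < n" by auto
    \<comment> \<open>Its \<open>j\<close>-th diagonal entry is 1, so multiplying by it on the right
      keeps column \<open>j\<close> of \<open>Y * U\<close>.\<close>
    let ?D = "real_diag n (\<lambda>i. if l i = l j then 1 else 0)"
    have "Y * (U * ?D * mat_adjoint U) = 0\<^sub>m m n"
      using zero[OF ij(2)] by (simp add: spectral_fun_eq[OF U MU])
    then have "(Y * (U * ?D * mat_adjoint U)) * U = 0\<^sub>m m n" using U' by simp
    moreover have "(Y * (U * ?D * mat_adjoint U)) * U = (Y * U) * ?D"
      using U' Y by (simp add: as sq_assoc[of _ n])
    ultimately have "((Y * U) * ?D) $$ (i, j) = 0" using ij by simp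
    then show "(Y * U) $$ (i, j) = 0\<^sub>m m n $$ (i, j)"
      using ij by (simp add: real_diag_mult_right[OF YU])
  qed (use YU in auto)
  then have "(Y * U) * mat_adjoint U = 0\<^sub>m m n" using U'(2) by (simp add: left_mult_zero_mat[of _ n n])
  then show ?thesis using U' Y by (simp add: as)
qed

section \<open>Positive definite matrices: spectrum, commuting products, logarithms\<close>

lemma pos_def_hermitian: "pos_def n M \<Longrightarrow> hermitian n M"
  by (simp add: pos_def_def hermitian_def)

lemma pos_def_carrier: "pos_def n M \<Longrightarrow> M \<in> carrier_mat n n"
  by (simp add: pos_def_def)

lemma hermitian_carrier: "hermitian n M \<Longrightarrow> M \<in> carrier_mat n n"
  by (simp add: hermitian_def)

text \<open>Each eigenvalue is the value of the quadratic form at a unit eigenvector, a column of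
  \<open>U\<close>.\<close>

lemma pos_def_obtain:
  assumes M: "pos_def n M"
  obtains U l where "unitary_mat n U" "M = U * real_diag n l * mat_adjoint U" "\<And>i. i < n \<Longrightarrow> 0 < l i"
proof -
  obtain U l where U: "unitary_mat n U" and MU: "M = U * real_diag n l * mat_adjoint U"
    using hermitian_obtain[OF pos_def_hermitian[OF M]] .
  note U' = unitary_matD[OF U]
  have "0 < l i" if i: "i < n" for i
  proof -
    let ?u = "col U i"
    have MUU: "M * U = U * real_diag n l"
      unfolding MU using U' by (simp add: sq_assoc[of _ n])
    have Mu: "M *\<^sub>v ?u = of_real (l i) \<cdot>\<^sub>v ?u"
    proof (rule eq_vecI)
      fix k assume "k < dim_vec (of_real (l i) \<cdot>\<^sub>v ?u)"
      then have k: "k < n" using U' by auto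
      have "(M *\<^sub>v ?u) $ k = (M * U) $$ (k, i)"
        using k i U' pos_def_carrier[OF M] by auto
      also have "\<dots> = of_real (l i) * U $$ (k, i)"
        unfolding MUU using k i U' by (simp add: real_diag_mult_right)
      finally show "(M *\<^sub>v ?u) $ k = (of_real (l i) \<cdot>\<^sub>v ?u) $ k" using k i U' by simp
    qed (use U' pos_def_carrier[OF M] in auto)
    have uu: "?u \<bullet>c ?u = 1"
    proof -
      have "?u \<bullet>c ?u = (\<Sum>k<n. mat_adjoint U $$ (i, k) * U $$ (k, i))"
        using U' i by (simp add: scalar_prod_def atLeast0LessThan index_adjoint mult.commute)
      also have "\<dots> = (mat_adjoint U * U) $$ (i, i)"
        by (rule index_mult_sum[symmetric]) (use U' i in auto)
      finally show ?thesis using U' i by simp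
    qed
    have uc: "?u \<in> carrier_vec n" using U' i by auto
    have "?u \<noteq> 0\<^sub>v n" using uu uc by fastforce
    with M uc have "0 < Re ((M *\<^sub>v ?u) \<bullet>c ?u)" unfolding pos_def_def by blast
    also have "(M *\<^sub>v ?u) \<bullet>c ?u = of_real (l i)"
      unfolding Mu using uc uu by simp
    finally show ?thesis by simp
  qed
  with U MU that show thesis by blast
qed

text \<open>Lets identities such as \<open>sqrt x * sqrt x = x\<close>, valid on the positive
  spectrum, pass to matrices.\<close>

lemma spectral_fun_cong:
  assumes M: "pos_def n M" and fg: "\<And>x. 0 < x \<Longrightarrow> f x = g x"
  shows "spectral_fun f M = spectral_fun g M"
proof -
  obtain U l where U: "unitary_mat n U" and MU: "M = U * real_diag n l * mat_adjoint U"
    and l: "\<And>i. i < n \<Longrightarrow> 0 < l i" using pos_def_obtain[OF M] by metis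
  have "real_diag n (\<lambda>i. f (l i)) = real_diag n (\<lambda>i. g (l i))"
    using l fg by (intro eq_matI) (auto simp: real_diag_def mat_diag_def)
  then show ?thesis by (simp add: spectral_fun_eq[OF U MU])
qed

lemma spectral_fun_const_one:
  assumes M: "hermitian n M" shows "spectral_fun (\<lambda>_. 1) M = 1\<^sub>m n"
proof -
  obtain U l where U: "unitary_mat n U" and MU: "M = U * real_diag n l * mat_adjoint U"
    using hermitian_obtain[OF M] .
  have "real_diag n (\<lambda>_. 1) = 1\<^sub>m n" by (rule eq_matI) (auto simp: real_diag_def mat_diag_def)
  then show ?thesis using unitary_matD[OF U] by (simp add: spectral_fun_eq[OF U MU])
qed

lemma adjoint_inner:
  assumes "A \<in> carrier_mat n n" "x \<in> carrier_vec n" "(y :: complex vec) \<in> carrier_vec n"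
  shows "(A *\<^sub>v x) \<bullet>c y = x \<bullet>c (mat_adjoint A *\<^sub>v y)"
proof -
  have "(A *\<^sub>v x) \<bullet>c y = (\<Sum>i<n. \<Sum>j<n. A $$ (i, j) * x $ j * cnj (y $ i))"
    using assms by (simp add: scalar_prod_def atLeast0LessThan sum_distrib_right)
  also have "\<dots> = (\<Sum>j<n. \<Sum>i<n. A $$ (i, j) * x $ j * cnj (y $ i))" by (rule sum.swap)
  also have "\<dots> = x \<bullet>c (mat_adjoint A *\<^sub>v y)"
    using assms by (simp add: scalar_prod_def atLeast0LessThan sum_distrib_left index_adjoint mult_ac
      carrier_matD[OF adjoint_carrier[OF assms(1)]])
  finally show ?thesis .
qed

text \<open>The square root \<open>S\<close> of \<open>F\<close> also commutes with
  \<open>G\<close>, so \<open>F * G = S * G * S\<close>, a congruence of \<open>G\<close> by an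
  injective self-adjoint matrix.\<close>

lemma pos_def_commuting_mult:
  assumes F: "pos_def n F" and G: "pos_def n G" and FG: "F * G = G * F"
  shows "pos_def n (F * G)"
  unfolding pos_def_def
proof (intro conjI ballI impI)
  note Fc = pos_def_carrier[OF F] and Gc = pos_def_carrier[OF G]
  note Fh = pos_def_hermitian[OF F]
  show "F * G \<in> carrier_mat n n" using Fc Gc by auto
  show "mat_adjoint (F * G) = F * G"
    using F G FG adjoint_mult[OF Fc Gc] by (simp add: pos_def_def)
  fix x :: "complex vec" assume x: "x \<in> carrier_vec n" "x \<noteq> 0\<^sub>v n"
  define S where "S = spectral_fun sqrt F"
  have S: "S \<in> carrier_mat n n" "mat_adjoint S = S"
    using hermitian_spectral_fun[OF Fh, of sqrt] by (auto simp: S_def hermitian_def)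
  have SS: "S * S = F"
    unfolding S_def spectral_fun_mult[OF Fh]
    using spectral_fun_cong[OF F, of "\<lambda>x. sqrt x * sqrt x" "\<lambda>x. x"] spectral_fun_id[OF Fh] by simp
  have SG: "S * G = G * S"
    unfolding S_def by (rule spectral_fun_intertwine[OF Fh Fh Gc FG])
  have eq: "F * G = S * (G * S)"
    unfolding SS[symmetric] using S Gc by (simp add: sq_assoc[of _ n] SG)
  have Sx: "S *\<^sub>v x \<in> carrier_vec n" using S x by auto
  \<comment> \<open>Otherwise \<open>F\<close> would annihilate \<open>x\<close>, since it is the
    square of \<open>S\<close>.\<close>
  have "S *\<^sub>v x \<noteq> 0\<^sub>v n"
  proof
    assume "S *\<^sub>v x = 0\<^sub>v n"
    then have "S *\<^sub>v (S *\<^sub>v x) = 0\<^sub>v n" using S by (auto intro!: eq_vecI simp: scalar_prod_def)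
    then have "F *\<^sub>v x = 0\<^sub>v n" using S x SS by (metis assoc_mult_mat_vec)
    then have "Re ((F *\<^sub>v x) \<bullet>c x) = 0" using x by simp
    then show False using F x unfolding pos_def_def by force
  qed
  with G Sx have "0 < Re ((G *\<^sub>v (S *\<^sub>v x)) \<bullet>c (S *\<^sub>v x))" unfolding pos_def_def by blast
  also have "(G *\<^sub>v (S *\<^sub>v x)) \<bullet>c (S *\<^sub>v x) = (S *\<^sub>v (G *\<^sub>v (S *\<^sub>v x))) \<bullet>c x"
    using adjoint_inner[OF S(1) _ x(1), of "G *\<^sub>v (S *\<^sub>v x)"] Gc Sx S(2) by simp
  also have "S *\<^sub>v (G *\<^sub>v (S *\<^sub>v x)) = (F * G) *\<^sub>v x"
    unfolding eq using S Gc x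
    by (simp add: assoc_mult_mat_vec[where ?n\<^sub>1.0 = n and ?n\<^sub>2.0 = n and ?n\<^sub>3.0 = n])
  finally show "0 < Re (((F * G) *\<^sub>v x) \<bullet>c x)" .
qed

text \<open>The square root of \<open>N\<close> commutes with whatever commutes with
  \<open>N\<close>, so its two copies meet.\<close>

lemma star_commuting:
  assumes N: "pos_def n N" and M: "M \<in> carrier_mat n n" and MN: "M * N = N * M"
  shows "M \<star> N = M * N"
proof -
  note Nh = pos_def_hermitian[OF N]
  let ?S = "spectral_fun sqrt N"
  have S: "?S \<in> carrier_mat n n" using hermitian_spectral_fun[OF Nh] by (simp add: hermitian_def)
  have SM: "?S * M = M * ?S"
    by (rule spectral_fun_intertwine[OF Nh Nh M MN[symmetric]])
  have SS: "?S * ?S = N"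
    unfolding spectral_fun_mult[OF Nh]
    using spectral_fun_cong[OF N, of "\<lambda>x. sqrt x * sqrt x" "\<lambda>x. x"] spectral_fun_id[OF Nh] by simp
  show ?thesis unfolding star_def SM using S M SS by (simp add: sq_assoc[of _ n])
qed

text \<open>Avoids simultaneous diagonalization: the two sides agree after multiplication by every
  product of a spectral projection of \<open>F\<close> with one of \<open>G\<close>.\<close>

lemma ln_commuting_mult:
  assumes F: "pos_def n F" and G: "pos_def n G" and FG: "F * G = G * F"
  shows "spectral_fun ln (F * G) = spectral_fun ln F + spectral_fun ln G"
proof -
  note Fh = pos_def_hermitian[OF F] and Gh = pos_def_hermitian[OF G]
  note Kh = pos_def_hermitian[OF pos_def_commuting_mult[OF F G FG]]
  note Fc = pos_def_carrier[OF F] and Gc = pos_def_carrier[OF G] and Kc = hermitian_carrier[OF Kh]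
  note sfc = hermitian_carrier[OF hermitian_spectral_fun]
  obtain U l where U: "unitary_mat n U" and FU: "F = U * real_diag n l * mat_adjoint U"
    and l: "\<And>i. i < n \<Longrightarrow> 0 < l i" using pos_def_obtain[OF F] by metis
  obtain W k where W: "unitary_mat n W" and GW: "G = W * real_diag n k * mat_adjoint W"
    and k: "\<And>i. i < n \<Longrightarrow> 0 < k i" using pos_def_obtain[OF G] by metis
  \<comment> \<open>Indicators of single points; the functional calculus turns them into spectral
    projections.\<close>
  let ?ind = "\<lambda>a x. if x = a then 1 else (0::real)"
  define P where "P a = spectral_fun (?ind a) F" for a
  define R where "R a = spectral_fun (?ind a) G" for a
  have Pc: "P a \<in> carrier_mat n n" and Rc: "R a \<in> carrier_mat n n" for a
    using sfc[OF Fh] sfc[OF Gh] by (auto simp: P_def R_def)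
  have proj: "M * spectral_fun (?ind a) M = of_real a \<cdot>\<^sub>m spectral_fun (?ind a) M" if M: "hermitian n M" for M a
  proof -
    obtain U l where U: "unitary_mat n U" and MU: "M = U * real_diag n l * mat_adjoint U"
      using hermitian_obtain[OF M] .
    have "real_diag n (\<lambda>i. l i * ?ind a (l i)) = of_real a \<cdot>\<^sub>m real_diag n (\<lambda>i. ?ind a (l i))"
      by (intro eq_matI) (auto simp: real_diag_def mat_diag_def)
    then have "spectral_fun (\<lambda>x. x * ?ind a x) M = of_real a \<cdot>\<^sub>m spectral_fun (?ind a) M"
      using unitary_matD[OF U]
      by (simp add: spectral_fun_eq[OF U MU] mult_smult_distrib[where nr = n and n = n and nc = n]
          mult_smult_assoc_mat[where nr = n and n = n and nc = n])
    then show ?thesis using spectral_fun_mult[OF M, of "\<lambda>x. x" "?ind a"] by (simp add: spectral_fun_id[OF M])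
  qed
  have "F * R b = R b * F" for b
    unfolding R_def using spectral_fun_intertwine[OF Gh Gh Fc FG[symmetric]] by simp
  then have PR: "P a * R b = R b * P a" for a b
    unfolding P_def using spectral_fun_intertwine[OF Fh Fh Rc] by simp
  let ?LK = "spectral_fun ln (F * G)" and ?LF = "spectral_fun ln F" and ?LG = "spectral_fun ln G"
  note Lc = sfc[OF Kh, of ln] sfc[OF Fh, of ln] sfc[OF Gh, of ln]
  define X where "X = ?LK - (?LF + ?LG)"
  have Xc: "X \<in> carrier_mat n n" using Lc by (auto simp: X_def)
  \<comment> \<open>On the range of \<open>P a * R b\<close> the matrices \<open>F\<close>,
    \<open>G\<close> and \<open>F * G\<close> act as the scalars \<open>a\<close>, \<open>b\<close>
    and \<open>a * b\<close>, so the claim reduces to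
    \<open>ln (a * b) = ln a + ln b\<close>.\<close>
  have XPR: "X * (P a * R b) = 0\<^sub>m n n" if ab: "0 < a" "0 < b" for a b
  proof -
    let ?Z = "P a * R b"
    have Z: "?Z \<in> carrier_mat n n" using Pc Rc by auto
    have FZ: "F * ?Z = of_real a \<cdot>\<^sub>m ?Z"
      using proj[OF Fh, of a, folded P_def] Fc Pc Rc
      by (simp add: sq_assoc[of _ n, symmetric] mult_smult_assoc_mat[where nr = n and n = n and nc = n])
    have GZ: "G * ?Z = of_real b \<cdot>\<^sub>m ?Z"
      unfolding PR using proj[OF Gh, of b, folded R_def] Gc Pc Rc
      by (simp add: sq_assoc[of _ n, symmetric] mult_smult_assoc_mat[where nr = n and n = n and nc = n])
    have "F * G * ?Z = of_real b \<cdot>\<^sub>m (F * ?Z)"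
      using Fc Gc Z by (simp add: sq_assoc[of _ n] GZ mult_smult_distrib[where nr = n and n = n and nc = n])
    then have KZ: "F * G * ?Z = of_real (a * b) \<cdot>\<^sub>m ?Z"
      using Z by (intro eq_matI) (auto simp: FZ)
    have "X * ?Z = ?LK * ?Z - (?LF * ?Z + ?LG * ?Z)"
      using Lc Z by (simp add: X_def minus_mult_distrib_mat[where nr = n and n = n and nc = n]
          add_mult_distrib_mat[where nr = n and n = n and nc = n])
    also have "\<dots> = of_real (ln (a * b)) \<cdot>\<^sub>m ?Z - (of_real (ln a) \<cdot>\<^sub>m ?Z + of_real (ln b) \<cdot>\<^sub>m ?Z)"
      by (simp add: spectral_fun_eigen[OF Kh Z KZ] spectral_fun_eigen[OF Fh Z FZ] spectral_fun_eigen[OF Gh Z GZ])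
    also have "\<dots> = 0\<^sub>m n n"
      using carrier_matD[OF Z] ab by (intro eq_matI) (simp_all add: ln_mult distrib_right del: index_mult_mat)
    finally show ?thesis .
  qed
  \<comment> \<open>The projections of \<open>G\<close> are removed first, for each eigenvalue of
    \<open>F\<close>; then those of \<open>F\<close>.\<close>
  have "X * P (l i) = 0\<^sub>m n n" if i: "i < n" for i
  proof (rule mult_indicator_spectral_fun_zero[OF W GW])
    show "X * P (l i) \<in> carrier_mat n n" using Xc Pc by auto
    fix j assume "j < n"
    then have "X * (P (l i) * R (k j)) = 0\<^sub>m n n" using XPR[OF l[OF i] k] by simp
    then show "X * P (l i) * spectral_fun (?ind (k j)) G = 0\<^sub>m n n"
      unfolding R_def[symmetric] using Xc Pc Rc by (simp add: sq_assoc[of _ n])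
  qed
  then have X0: "X = 0\<^sub>m n n"
    unfolding P_def by (intro mult_indicator_spectral_fun_zero[OF U FU Xc]) simp
  have "?LK = X + (?LF + ?LG)" using Lc by (intro eq_matI) (auto simp: X_def)
  then show ?thesis using X0 Lc by simp
qed

text \<open>Converse of \<open>pos_def_obtain\<close>: in the coordinates
  \<open>mat_adjoint U *\<^sub>v x\<close> the form is a sum of squares with weights
  \<open>l\<close>.\<close>

lemma pos_def_conj_real_diag:
  assumes U: "unitary_mat n U" and l: "\<And>i. i < n \<Longrightarrow> 0 < l i"
  shows "pos_def n (U * real_diag n l * mat_adjoint U)"
  unfolding pos_def_def
proof (intro conjI ballI impI)
  note U' = unitary_matD[OF U]
  let ?M = "U * real_diag n l * mat_adjoint U"
  show "?M \<in> carrier_mat n n" "mat_adjoint ?M = ?M"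
    using hermitian_conj_real_diag[OF U, of l] by (simp_all add: hermitian_def)
  fix x :: "complex vec" assume x: "x \<in> carrier_vec n" "x \<noteq> 0\<^sub>v n"
  define y where "y = mat_adjoint U *\<^sub>v x"
  have y: "y \<in> carrier_vec n" unfolding y_def by (rule mult_mat_vec_carrier[OF U'(2) x(1)])
  have xy: "x = U *\<^sub>v y"
    using U' x by (simp add: y_def assoc_mult_mat_vec[where ?n\<^sub>1.0 = n and ?n\<^sub>2.0 = n and ?n\<^sub>3.0 = n, symmetric])
  have "y \<noteq> 0\<^sub>v n"
  proof
    assume "y = 0\<^sub>v n"
    then have "x = 0\<^sub>v n" using U' xy by (auto intro!: eq_vecI)
    then show False using x by simp
  qed
  then obtain i where i: "i < n" "y $ i \<noteq> 0" using y by (metis carrier_vecD eq_vecI index_zero_vec)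
  have Dy: "real_diag n l *\<^sub>v y \<in> carrier_vec n" by (rule mult_mat_vec_carrier[OF real_diag_carrier y])
  have "(?M *\<^sub>v x) \<bullet>c x = (U *\<^sub>v (real_diag n l *\<^sub>v y)) \<bullet>c x"
    using U' x y unfolding y_def by (simp add: mult_mat_vec_carrier[of _ n n] assoc_mult_mat_vec[where ?n\<^sub>1.0 = n and ?n\<^sub>2.0 = n and ?n\<^sub>3.0 = n])
  also have "\<dots> = (real_diag n l *\<^sub>v y) \<bullet>c y"
    using adjoint_inner[OF U'(1) Dy x(1)] by (simp add: y_def)
  also have "\<dots> = (\<Sum>k<n. of_real (l k * (cmod (y $ k))\<^sup>2))"
  proof -
    have "(real_diag n l *\<^sub>v y) $ k = of_real (l k) * y $ k" if "k < n" for k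
    proof -
      have "(real_diag n l *\<^sub>v y) $ k = (\<Sum>j<n. real_diag n l $$ (k, j) * y $ j)"
        using y that by (simp add: scalar_prod_def atLeast0LessThan)
      also have "\<dots> = (\<Sum>j<n. if j = k then of_real (l k) * y $ k else 0)"
        using that by (intro sum.cong) (auto simp: index_real_diag)
      finally show ?thesis using that by simp
    qed
    then show ?thesis
      using y unfolding scalar_prod_def
      by (intro sum.cong) (auto simp: atLeast0LessThan mult.assoc complex_norm_square[symmetric] simp del: index_mult_mat_vec)
  qed
  finally have "Re ((?M *\<^sub>v x) \<bullet>c x) = (\<Sum>k<n. l k * (cmod (y $ k))\<^sup>2)" by simp
  also have "\<dots> > 0"
    using i l by (intro sum_pos2[of _ i]) (auto simp: less_imp_le)
  finally show "0 < Re ((?M *\<^sub>v x) \<bullet>c x)" .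
qed

section \<open>Embeddings and partial traces\<close>

lemma finite_configs [simp]: "finite A \<Longrightarrow> finite (configs d A)"
  unfolding configs_def by (rule finite_PiE) auto

lemma bij_betw_config_number:
  "finite A \<Longrightarrow> bij_betw (to_nat_on (configs d A)) (configs d A) {..<hdim d A}"
  unfolding hdim_def by (rule to_nat_on_finite) simp

lemma config_number_less: "finite A \<Longrightarrow> x \<in> configs d A \<Longrightarrow> to_nat_on (configs d A) x < hdim d A"
  using bij_betw_config_number[of A d] by (auto dest: bij_betwE)

lemma config_of_number [simp]:
  "finite A \<Longrightarrow> x \<in> configs d A \<Longrightarrow> from_nat_into (configs d A) (to_nat_on (configs d A) x) = x"
  by (simp add: countable_finite)

lemma config_number_of:
  assumes "finite A" "i < hdim d A"
  shows "from_nat_into (configs d A) i \<in> configs d A"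
    "to_nat_on (configs d A) (from_nat_into (configs d A) i) = i"
proof -
  obtain x where "x \<in> configs d A" "i = to_nat_on (configs d A) x"
    using assms bij_betw_config_number[OF assms(1), of d] unfolding bij_betw_def by auto
  then show "from_nat_into (configs d A) i \<in> configs d A"
    "to_nat_on (configs d A) (from_nat_into (configs d A) i) = i"
    using assms(1) by auto
qed

lemma config_number_inj:
  "finite A \<Longrightarrow> x \<in> configs d A \<Longrightarrow> y \<in> configs d A \<Longrightarrow>
   to_nat_on (configs d A) x = to_nat_on (configs d A) y \<longleftrightarrow> x = y"
  by (metis config_of_number)

lemma op_of_carrier [simp]: "op_of d A f \<in> carrier_mat (hdim d A) (hdim d A)"
  by (simp add: op_of_def)

lemma embed_op_carrier [simp]: "embed_op d A B M \<in> carrier_mat (hdim d B) (hdim d B)"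
  by (simp add: embed_op_def)

lemma ptrace_carrier [simp]: "ptrace d B A M \<in> carrier_mat (hdim d A) (hdim d A)"
  by (simp add: ptrace_def)

lemma entry_op_of [simp]:
  "finite A \<Longrightarrow> x \<in> configs d A \<Longrightarrow> y \<in> configs d A \<Longrightarrow> entry d A (op_of d A f) x y = f x y"
  by (simp add: entry_def op_of_def config_number_less)

text \<open>Hides the numbering of the basis: operators can be compared through their entries at
  configurations.\<close>

lemma operator_eqI:
  assumes "finite A" "M \<in> carrier_mat (hdim d A) (hdim d A)" "N \<in> carrier_mat (hdim d A) (hdim d A)"
    and "\<And>x y. x \<in> configs d A \<Longrightarrow> y \<in> configs d A \<Longrightarrow> entry d A M x y = entry d A N x y"
  shows "M = N"
proof (rule eq_matI)
  fix i j assume "i < dim_row N" "j < dim_col N"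
  then have ij: "i < hdim d A" "j < hdim d A" using assms(3) by auto
  show "M $$ (i, j) = N $$ (i, j)"
    using assms(4)[OF config_number_of(1)[OF assms(1) ij(1)] config_number_of(1)[OF assms(1) ij(2)]]
    by (simp add: entry_def config_number_of[OF assms(1) ij(1)] config_number_of[OF assms(1) ij(2)])
qed (use assms in auto)

lemma sum_config_number:
  "finite A \<Longrightarrow> (\<Sum>i<hdim d A. f i) = (\<Sum>x\<in>configs d A. f (to_nat_on (configs d A) x))"
  by (rule sum.reindex_bij_betw[symmetric]) (rule bij_betw_config_number)

lemma entry_mult:
  assumes "finite A" "M \<in> carrier_mat (hdim d A) (hdim d A)" "N \<in> carrier_mat (hdim d A) (hdim d A)"
    "x \<in> configs d A" "y \<in> configs d A"
  shows "entry d A (M * N) x y = (\<Sum>z\<in>configs d A. entry d A M x z * entry d A N z y)"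
  unfolding entry_def using assms
  by (subst index_mult_sum[where n = "hdim d A" and m = "hdim d A" and k = "hdim d A"])
    (auto simp: config_number_less sum_config_number)

lemma entry_adjoint:
  assumes "finite A" "M \<in> carrier_mat (hdim d A) (hdim d A)" "x \<in> configs d A" "y \<in> configs d A"
  shows "entry d A (mat_adjoint M) x y = cnj (entry d A M y x)"
  unfolding entry_def using assms by (simp add: index_adjoint config_number_less)

lemma entry_one:
  "finite A \<Longrightarrow> x \<in> configs d A \<Longrightarrow> y \<in> configs d A \<Longrightarrow>
   entry d A (1\<^sub>m (hdim d A)) x y = (if x = y then 1 else 0)"
  unfolding entry_def by (simp add: config_number_less config_number_inj)

lemma entry_real_diag:
  "finite A \<Longrightarrow> x \<in> configs d A \<Longrightarrow> y \<in> configs d A \<Longrightarrow>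
   entry d A (real_diag (hdim d A) l) x y = (if x = y then of_real (l (to_nat_on (configs d A) x)) else 0)"
  unfolding entry_def by (simp add: config_number_less config_number_inj index_real_diag)

lemma mtrace_entry:
  "finite A \<Longrightarrow> M \<in> carrier_mat (hdim d A) (hdim d A) \<Longrightarrow> mtrace M = (\<Sum>x\<in>configs d A. entry d A M x x)"
  unfolding mtrace_def entry_def by (simp add: sum_config_number)

lemma restrict_config: "x \<in> configs d B \<Longrightarrow> A \<subseteq> B \<Longrightarrow> restrict x A \<in> configs d A"
  by (auto simp: configs_def PiE_def)

text \<open>\<open>override_on z x A\<close> is \<open>x\<close> on \<open>A\<close> and
  \<open>z\<close> elsewhere; it plays the role of the tensor product of two basis vectors.\<close>

lemma glue_config:
  "x \<in> configs d A \<Longrightarrow> z \<in> configs d (B - A) \<Longrightarrow> A \<subseteq> B \<Longrightarrow> override_on z x A \<in> configs d B"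
  by (auto simp: configs_def PiE_def Pi_def extensional_def override_on_def)

lemma config_eqI:
  assumes "x \<in> configs d A" "y \<in> configs d A" "\<And>v. v \<in> A \<Longrightarrow> x v = y v" shows "x = y"
  using assms unfolding configs_def by (auto intro: PiE_ext)

lemma restrict_glue_left: "x \<in> configs d A \<Longrightarrow> restrict (override_on z x A) A = x"
  by (auto simp: configs_def PiE_def extensional_def override_on_def restrict_def fun_eq_iff)

lemma restrict_glue_right: "z \<in> configs d (B - A) \<Longrightarrow> restrict (override_on z x A) (B - A) = z"
  by (auto simp: configs_def PiE_def extensional_def override_on_def restrict_def fun_eq_iff)

lemma glue_restrict: "x \<in> configs d B \<Longrightarrow> A \<subseteq> B \<Longrightarrow> override_on (restrict x (B - A)) (restrict x A) A = x"
  by (auto simp: configs_def PiE_def extensional_def override_on_def restrict_def fun_eq_iff)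

lemma sum_configs_split:
  assumes "A \<subseteq> B"
  shows "(\<Sum>x\<in>configs d B. f x) = (\<Sum>w\<in>configs d A. \<Sum>z\<in>configs d (B - A). f (override_on z w A))"
proof -
  have "(\<Sum>x\<in>configs d B. f x) = (\<Sum>(w, z)\<in>configs d A \<times> configs d (B - A). f (override_on z w A))"
    by (rule sum.reindex_bij_witness[where i = "\<lambda>(w, z). override_on z w A" and j = "\<lambda>x. (restrict x A, restrict x (B - A))"])
      (use assms in \<open>auto simp: glue_config glue_restrict restrict_config restrict_glue_left restrict_glue_right\<close>)
  then show ?thesis by (simp add: sum.cartesian_product)
qed

section \<open>Embedding as an injective homomorphism of operator algebras\<close>

lemma entry_embed_op:
  assumes "finite B" "x \<in> configs d B" "y \<in> configs d B"
  shows "entry d B (embed_op d A B M) x y =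
    (if \<forall>v\<in>B - A. x v = y v then entry d A M (restrict x A) (restrict y A) else 0)"
  using assms by (simp add: embed_op_def)

lemma entry_ptrace:
  assumes "finite A" "x \<in> configs d A" "y \<in> configs d A"
  shows "entry d A (ptrace d B A M) x y =
    (\<Sum>z\<in>configs d (B - A). entry d B M (override_on z x A) (override_on z y A))"
  using assms by (simp add: ptrace_def)

lemma sum_if_const: "(\<Sum>w\<in>X. if P then f w else 0) = (if P then sum f X else 0)"
  by (cases P) simp_all

text \<open>Product of two Kronecker deltas, the second simplified under the first and the outer
  condition put into the shape that \<open>sum.delta\<close> expects.\<close>

lemma if_mult_if:
  "(c \<longleftrightarrow> P) \<Longrightarrow> (P \<Longrightarrow> Q \<longleftrightarrow> R) \<Longrightarrow>
   (if P then a else 0) * (if Q then b else 0) = (if c then (if R then a * b else 0) else (0 :: complex))"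
  by auto

lemma embed_op_mult:
  assumes B: "finite B" and AB: "A \<subseteq> B"
    and M: "M \<in> carrier_mat (hdim d A) (hdim d A)" and N: "N \<in> carrier_mat (hdim d A) (hdim d A)"
  shows "embed_op d A B (M * N) = embed_op d A B M * embed_op d A B N"
proof (rule operator_eqI[OF B])
  have A: "finite A" using finite_subset[OF AB B] .
  fix x y assume x: "x \<in> configs d B" and y: "y \<in> configs d B"
  note xA = restrict_config[OF x AB] and yA = restrict_config[OF y AB]
  \<comment> \<open>Of the intermediate configuration only the part \<open>w\<close> on
    \<open>A\<close> is free; off \<open>A\<close> the deltas force it to agree with
    \<open>x\<close>.\<close>
  have inner: "(\<Sum>z\<in>configs d (B - A). entry d B (embed_op d A B M) x (override_on z w A)
        * entry d B (embed_op d A B N) (override_on z w A) y)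
      = (if \<forall>v\<in>B - A. x v = y v then entry d A M (restrict x A) w * entry d A N w (restrict y A) else 0)"
    if w: "w \<in> configs d A" for w
  proof -
    have "(\<Sum>z\<in>configs d (B - A). entry d B (embed_op d A B M) x (override_on z w A)
        * entry d B (embed_op d A B N) (override_on z w A) y)
      = (\<Sum>z\<in>configs d (B - A). if z = restrict x (B - A) then
         (if \<forall>v\<in>B - A. x v = y v then entry d A M (restrict x A) w * entry d A N w (restrict y A) else 0) else 0)"
    proof (rule sum.cong[OF refl])
      fix z assume z: "z \<in> configs d (B - A)"
      note g = glue_config[OF w z AB]
      have "z = restrict x (B - A) \<longleftrightarrow> (\<forall>v\<in>B - A. x v = override_on z w A v)"
        using config_eqI[OF z restrict_config[OF x]] by (auto simp: override_on_def)
      moreover have "(\<forall>v\<in>B - A. override_on z w A v = y v) \<longleftrightarrow> (\<forall>v\<in>B - A. x v = y v)"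
        if "\<forall>v\<in>B - A. x v = override_on z w A v" using that by simp
      ultimately show "entry d B (embed_op d A B M) x (override_on z w A) * entry d B (embed_op d A B N) (override_on z w A) y
        = (if z = restrict x (B - A) then (if \<forall>v\<in>B - A. x v = y v
            then entry d A M (restrict x A) w * entry d A N w (restrict y A) else 0) else 0)"
        unfolding entry_embed_op[OF B x g] entry_embed_op[OF B g y] restrict_glue_left[OF w]
        by (rule if_mult_if)
    qed
    also have "\<dots> = (if \<forall>v\<in>B - A. x v = y v then entry d A M (restrict x A) w * entry d A N w (restrict y A) else 0)"
      using B restrict_config[OF x, of "B - A"] by (subst sum.delta) auto
    finally show ?thesis .
  qed
  have prod: "entry d B (embed_op d A B M * embed_op d A B N) x y
      = (\<Sum>w\<in>configs d A. if \<forall>v\<in>B - A. x v = y v then entry d A M (restrict x A) w * entry d A N w (restrict y A) else 0)"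
    using B x y by (simp add: entry_mult sum_configs_split[OF AB] inner)
  show "entry d B (embed_op d A B (M * N)) x y = entry d B (embed_op d A B M * embed_op d A B N) x y"
    by (simp only: prod entry_embed_op[OF B x y] entry_mult[OF A M N xA yA] sum_if_const)
qed simp_all

lemma embed_op_one:
  assumes B: "finite B" and AB: "A \<subseteq> B"
  shows "embed_op d A B (1\<^sub>m (hdim d A)) = 1\<^sub>m (hdim d B)"
proof (rule operator_eqI[OF B])
  fix x y assume x: "x \<in> configs d B" and y: "y \<in> configs d B"
  have "x = y \<longleftrightarrow> (\<forall>v\<in>B - A. x v = y v) \<and> restrict x A = restrict y A"
    using config_eqI[OF x y] by (auto simp: restrict_def fun_eq_iff)
  then show "entry d B (embed_op d A B (1\<^sub>m (hdim d A))) x y = entry d B (1\<^sub>m (hdim d B)) x y"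
    using B x y AB finite_subset[OF AB B] by (auto simp: entry_embed_op entry_one restrict_config)
qed simp_all

lemma embed_op_adjoint:
  assumes B: "finite B" and AB: "A \<subseteq> B" and M: "M \<in> carrier_mat (hdim d A) (hdim d A)"
  shows "mat_adjoint (embed_op d A B M) = embed_op d A B (mat_adjoint M)"
  using B AB M finite_subset[OF AB B]
  by (intro operator_eqI[OF B, where d = d]) (auto simp: entry_embed_op entry_adjoint restrict_config)

lemma embed_op_self:
  assumes B: "finite B" and M: "M \<in> carrier_mat (hdim d B) (hdim d B)"
  shows "embed_op d B B M = M"
proof (rule operator_eqI[OF B])
  have "restrict x B = x" if "x \<in> configs d B" for x
    using that by (auto simp: configs_def)
  then show "entry d B (embed_op d B B M) x y = entry d B M x y"
    if "x \<in> configs d B" "y \<in> configs d B" for x y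
    using B that by (simp add: entry_embed_op)
qed (use M in simp_all)

lemma embed_op_embed_op:
  assumes C: "finite C" and AB: "A \<subseteq> B" and BC: "B \<subseteq> C"
  shows "embed_op d B C (embed_op d A B M) = embed_op d A C M"
proof (rule operator_eqI[OF C])
  have B: "finite B" using finite_subset[OF BC C] .
  fix x y assume x: "x \<in> configs d C" and y: "y \<in> configs d C"
  have "(\<forall>v\<in>C - A. x v = y v) \<longleftrightarrow> (\<forall>v\<in>C - B. x v = y v) \<and> (\<forall>v\<in>B - A. restrict x B v = restrict y B v)"
    using AB BC by auto
  moreover have "restrict (restrict x B) A = restrict x A" "restrict (restrict y B) A = restrict y A"
    using AB by (simp_all add: Int_absorb1)
  ultimately show "entry d C (embed_op d B C (embed_op d A B M)) x y = entry d C (embed_op d A C M) x y"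
    using C B x y BC by (simp add: entry_embed_op restrict_config)
qed simp_all

lemma configs_nonempty:
  assumes "\<And>v. v \<in> A \<Longrightarrow> 0 < d v" shows "\<exists>z. z \<in> configs d A"
  using assms by (intro exI[of _ "\<lambda>v\<in>A. 0"]) (auto simp: configs_def)

text \<open>Fixing any configuration \<open>z\<close> off \<open>A\<close> cuts out of the embedded
  operator a block equal to the original. Such a \<open>z\<close> exists because all dimensions are
  positive.\<close>

lemma embed_op_inj:
  assumes B: "finite B" and AB: "A \<subseteq> B" and pos: "\<And>v. v \<in> B \<Longrightarrow> 0 < d v"
    and M: "M \<in> carrier_mat (hdim d A) (hdim d A)" and N: "N \<in> carrier_mat (hdim d A) (hdim d A)"
    and eq: "embed_op d A B M = embed_op d A B N"
  shows "M = N"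
proof (rule operator_eqI[OF finite_subset[OF AB B] M N])
  obtain z where z: "z \<in> configs d (B - A)" using configs_nonempty[of "B - A" d] pos by auto
  fix x y assume x: "x \<in> configs d A" and y: "y \<in> configs d A"
  note g = glue_config[OF x z AB] glue_config[OF y z AB]
  have "entry d B (embed_op d A B K) (override_on z x A) (override_on z y A) = entry d A K x y" for K
    using B g x y by (auto simp: entry_embed_op restrict_glue_left)
  then show "entry d A M x y = entry d A N x y" using eq by metis
qed

section \<open>Partial traces, in particular of products\<close>

lemma ptrace_self:
  assumes B: "finite B" and M: "M \<in> carrier_mat (hdim d B) (hdim d B)"
  shows "ptrace d B B M = M"
proof (rule operator_eqI[OF B])
  have "override_on (\<lambda>_. undefined) x B = x" if "x \<in> configs d B" for x
    using that by (auto simp: configs_def PiE_def extensional_def override_on_def)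
  moreover have "configs d {} = {\<lambda>_. undefined}" by (simp add: configs_def)
  ultimately show "entry d B (ptrace d B B M) x y = entry d B M x y"
    if "x \<in> configs d B" "y \<in> configs d B" for x y
    using B that by (simp add: entry_ptrace)
qed (use M in simp_all)

lemma ptrace_ptrace:
  assumes C: "finite C" and AB: "A \<subseteq> B" and BC: "B \<subseteq> C"
  shows "ptrace d B A (ptrace d C B M) = ptrace d C A M"
proof (rule operator_eqI)
  have B: "finite B" using finite_subset[OF BC C] .
  show A: "finite A" using finite_subset[OF AB B] .
  fix x y assume x: "x \<in> configs d A" and y: "y \<in> configs d A"
  have sub: "B - A \<subseteq> C - A" and eq: "C - A - (B - A) = C - B" using AB BC by auto
  have ov: "override_on (override_on u z (B - A)) w A = override_on u (override_on z w A) B" for u z w :: "'a \<Rightarrow> nat"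
    using AB by (auto simp: override_on_def fun_eq_iff)
  show "entry d A (ptrace d B A (ptrace d C B M)) x y = entry d A (ptrace d C A M) x y"
    using A B x y AB
    by (simp add: entry_ptrace glue_config sum_configs_split[OF sub] eq ov)
qed simp_all

lemma ptrace_adjoint:
  assumes B: "finite B" and AB: "A \<subseteq> B" and M: "M \<in> carrier_mat (hdim d B) (hdim d B)"
  shows "mat_adjoint (ptrace d B A M) = ptrace d B A (mat_adjoint M)"
  using B AB M finite_subset[OF AB B]
  by (intro operator_eqI[OF finite_subset[OF AB B], where d = d]) (auto simp: entry_ptrace entry_adjoint glue_config)

lemma mtrace_ptrace:
  assumes B: "finite B" and AB: "A \<subseteq> B" and M: "M \<in> carrier_mat (hdim d B) (hdim d B)"
  shows "mtrace (ptrace d B A M) = mtrace M"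
proof -
  have A: "finite A" using finite_subset[OF AB B] .
  show ?thesis
    by (simp add: mtrace_entry[OF A ptrace_carrier] mtrace_entry[OF B M] entry_ptrace[OF A] sum_configs_split[OF AB])
qed

text \<open>The traced factors lie outside \<open>D\<close>, where the embedded \<open>G\<close> is
  the identity; hence \<open>G\<close> leaves the trace unchanged and only \<open>F\<close> is
  reduced.\<close>

lemma ptrace_mult:
  assumes W: "finite W" and CD: "C \<union> D = W" and DT: "D \<subseteq> T" and TW: "T \<subseteq> W"
  shows "ptrace d W T (embed_op d C W F * embed_op d D W G) =
    embed_op d (C \<inter> T) T (ptrace d C (C \<inter> T) F) * embed_op d D T G"
proof (rule operator_eqI)
  show T: "finite T" using finite_subset[OF TW W] .
  have fin: "finite C" "finite D" "finite (C \<inter> T)" using CD W T by auto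
  fix x y assume x: "x \<in> configs d T" and y: "y \<in> configs d T"
  have sets: "C - C \<inter> T = W - T" "W - D \<supseteq> W - T" using CD DT TW by auto
  \<comment> \<open>\<open>x\<close> and \<open>y\<close> are the outer indices, \<open>w\<close>
    the intermediate index on \<open>T\<close> and \<open>z\<close> the traced one. Only the factor
    from \<open>F\<close> depends on \<open>z\<close>.\<close>
  define FT where "FT w z = (if \<forall>v\<in>T - C \<inter> T. x v = w v
      then entry d C F (override_on z (restrict x (C \<inter> T)) (C \<inter> T)) (override_on z (restrict w (C \<inter> T)) (C \<inter> T)) else 0)"
    for w z
  define GT where "GT w = (if \<forall>v\<in>T - D. w v = y v then entry d D G (restrict w D) (restrict y D) else 0)" for w
  have inner: "(\<Sum>z'\<in>configs d (W - T). entry d W (embed_op d C W F) (override_on z x T) (override_on z' w T) *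
        entry d W (embed_op d D W G) (override_on z' w T) (override_on z y T)) = FT w z * GT w"
    if w: "w \<in> configs d T" and z: "z \<in> configs d (W - T)" for w z
  proof -
    have "(\<Sum>z'\<in>configs d (W - T). entry d W (embed_op d C W F) (override_on z x T) (override_on z' w T) *
        entry d W (embed_op d D W G) (override_on z' w T) (override_on z y T))
      = (\<Sum>z'\<in>configs d (W - T). if z' = z then FT w z * GT w else 0)"
    proof (rule sum.cong[OF refl])
      fix z' assume z': "z' \<in> configs d (W - T)"
      note g = glue_config[OF x z TW] glue_config[OF y z TW] glue_config[OF w z' TW]
      show "entry d W (embed_op d C W F) (override_on z x T) (override_on z' w T) *
          entry d W (embed_op d D W G) (override_on z' w T) (override_on z y T) = (if z' = z then FT w z * GT w else 0)"
      proof (cases "z' = z")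
        case True
        have r: "restrict (override_on z u T) C = override_on z (restrict u (C \<inter> T)) (C \<inter> T)" for u
          using z sets by (auto simp: configs_def PiE_def extensional_def override_on_def restrict_def fun_eq_iff)
        have rD: "restrict (override_on z u T) D = restrict u D" for u
          using DT by (auto simp: override_on_def restrict_def fun_eq_iff)
        have c: "(\<forall>v\<in>W - C. override_on z x T v = override_on z w T v) \<longleftrightarrow> (\<forall>v\<in>T - C \<inter> T. x v = w v)"
          using CD DT TW by (auto simp: override_on_def)
        have cD: "(\<forall>v\<in>W - D. override_on z w T v = override_on z y T v) \<longleftrightarrow> (\<forall>v\<in>T - D. w v = y v)"
          using CD DT TW by (auto simp: override_on_def)
        note g' = g(3)[unfolded True]
        show ?thesis
          unfolding True entry_embed_op[OF W g(1) g'] entry_embed_op[OF W g' g(2)] r rD c cD FT_def GT_def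
          by (simp only: refl if_True)
      next
        case False
        then obtain v where v: "v \<in> W - T" "z' v \<noteq> z v" using config_eqI[OF z' z] by blast
        \<comment> \<open>The intermediate and the final configuration differ at a traced vertex, so
          the delta of \<open>G\<close> vanishes.\<close>
        then have nd: "\<not> (\<forall>v\<in>W - D. override_on z' w T v = override_on z y T v)"
          using sets by (auto simp: override_on_def)
        show ?thesis
          by (simp only: entry_embed_op[OF W g(3) g(2)] if_not_P[OF nd] if_not_P[OF False] mult_zero_right)
      qed
    qed
    also have "\<dots> = FT w z * GT w" using W z by (subst sum.delta) auto
    finally show ?thesis .
  qed
  have "entry d T (ptrace d W T (embed_op d C W F * embed_op d D W G)) x y
      = (\<Sum>z\<in>configs d (W - T). \<Sum>w\<in>configs d T. FT w z * GT w)"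
    using T W x y TW by (simp add: entry_ptrace entry_mult glue_config sum_configs_split[OF TW] inner)
  also have "\<dots> = (\<Sum>w\<in>configs d T. (\<Sum>z\<in>configs d (W - T). FT w z) * GT w)"
    by (subst sum.swap) (simp add: sum_distrib_right)
  also have "\<dots> = entry d T (embed_op d (C \<inter> T) T (ptrace d C (C \<inter> T) F) * embed_op d D T G) x y"
  proof -
    have "entry d T (embed_op d (C \<inter> T) T (ptrace d C (C \<inter> T) F)) x w = (\<Sum>z\<in>configs d (W - T). FT w z)"
      if w: "w \<in> configs d T" for w
      by (simp only: entry_embed_op[OF T x w] entry_ptrace[OF fin(3) restrict_config[OF x Int_lower2] restrict_config[OF w Int_lower2]]
          sets(1) FT_def sum_if_const)
    then show ?thesis using T x y by (simp add: entry_mult entry_embed_op GT_def)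
  qed
  finally show "entry d T (ptrace d W T (embed_op d C W F * embed_op d D W G)) x y =
    entry d T (embed_op d (C \<inter> T) T (ptrace d C (C \<inter> T) F) * embed_op d D T G) x y" .
qed simp_all

text \<open>Mirror image of \<open>ptrace_mult\<close>, obtained by taking adjoints, which reverse
  products.\<close>

lemma ptrace_mult':
  assumes W: "finite W" and CD: "C \<union> D = W" and DT: "D \<subseteq> T" and TW: "T \<subseteq> W"
    and F: "F \<in> carrier_mat (hdim d C) (hdim d C)" and G: "G \<in> carrier_mat (hdim d D) (hdim d D)"
  shows "ptrace d W T (embed_op d D W G * embed_op d C W F) =
    embed_op d D T G * embed_op d (C \<inter> T) T (ptrace d C (C \<inter> T) F)"
proof -
  have sub: "C \<subseteq> W" "D \<subseteq> W" "finite C" "finite T" using CD W TW by (auto intro: finite_subset)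
  have "mat_adjoint (ptrace d W T (embed_op d D W G * embed_op d C W F))
      = ptrace d W T (embed_op d C W (mat_adjoint F) * embed_op d D W (mat_adjoint G))"
    using W TW sub F G
    by (simp add: ptrace_adjoint embed_op_adjoint adjoint_mult[where n = "hdim d W" and m = "hdim d W" and k = "hdim d W"])
  also have "\<dots> = embed_op d (C \<inter> T) T (ptrace d C (C \<inter> T) (mat_adjoint F)) * embed_op d D T (mat_adjoint G)"
    by (rule ptrace_mult[OF W CD DT TW])
  also have "\<dots> = mat_adjoint (embed_op d D T G * embed_op d (C \<inter> T) T (ptrace d C (C \<inter> T) F))"
    using DT sub F G
    by (simp add: ptrace_adjoint embed_op_adjoint adjoint_mult[where n = "hdim d T" and m = "hdim d T" and k = "hdim d T"])
  finally have "mat_adjoint (mat_adjoint (ptrace d W T (embed_op d D W G * embed_op d C W F)))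
    = mat_adjoint (mat_adjoint (embed_op d D T G * embed_op d (C \<inter> T) T (ptrace d C (C \<inter> T) F)))" by simp
  then show ?thesis by simp
qed

text \<open>Tracing in two stages through \<open>T \<union> D\<close>: the first stage affects only
  \<open>F\<close>. The second affects only \<open>G\<close>, because the reduced \<open>F\<close>
  already lives inside \<open>T\<close>.\<close>

lemma ptrace_mult_both:
  assumes W: "finite W" and CD: "C \<union> D = W" and T: "C \<inter> D \<subseteq> T" "T \<subseteq> W"
    and F: "F \<in> carrier_mat (hdim d C) (hdim d C)" and G: "G \<in> carrier_mat (hdim d D) (hdim d D)"
  shows "ptrace d W T (embed_op d C W F * embed_op d D W G) =
    embed_op d (C \<inter> T) T (ptrace d C (C \<inter> T) F) * embed_op d (D \<inter> T) T (ptrace d D (D \<inter> T) G)"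
proof -
  let ?T1 = "T \<union> D"
  have CT1: "C \<inter> ?T1 = C \<inter> T" using T by auto
  have fin: "finite ?T1" using CD W T by (auto intro: finite_subset)
  have "ptrace d W T (embed_op d C W F * embed_op d D W G)
      = ptrace d ?T1 T (ptrace d W ?T1 (embed_op d C W F * embed_op d D W G))"
    using W CD T by (intro ptrace_ptrace[symmetric]) auto
  also have "ptrace d W ?T1 (embed_op d C W F * embed_op d D W G)
      = embed_op d (C \<inter> T) ?T1 (ptrace d C (C \<inter> T) F) * embed_op d D ?T1 G"
    using ptrace_mult[OF W CD, of ?T1 d F G] CD T unfolding CT1 by auto
  also have "ptrace d ?T1 T \<dots> = embed_op d (C \<inter> T) T (ptrace d C (C \<inter> T) F) * embed_op d (D \<inter> T) T (ptrace d D (D \<inter> T) G)"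
    using CD T G by (intro ptrace_mult'[OF fin]) auto
  finally show ?thesis .
qed

lemma ptrace_mult_embed:
  assumes W: "finite W" and TW: "T \<subseteq> W"
    and M: "M \<in> carrier_mat (hdim d W) (hdim d W)" and X: "X \<in> carrier_mat (hdim d T) (hdim d T)"
  shows "ptrace d W T (M * embed_op d T W X) = ptrace d W T M * X"
proof -
  have "W \<inter> T = T" using TW by auto
  then show ?thesis
    using ptrace_mult[of W W T T d M X] assms finite_subset[OF TW W] by (auto simp: embed_op_self)
qed

text \<open>Duality of partial trace and embedding; it moves entropies of different marginals to one
  common space.\<close>

lemma mtrace_ptrace_mult:
  assumes W: "finite W" and TW: "T \<subseteq> W"
    and M: "M \<in> carrier_mat (hdim d W) (hdim d W)" and X: "X \<in> carrier_mat (hdim d T) (hdim d T)"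
  shows "mtrace (ptrace d W T M * X) = mtrace (M * embed_op d T W X)"
  using mtrace_ptrace[OF W TW, of "M * embed_op d T W X" d] ptrace_mult_embed[OF assms] M by simp

section \<open>Functional calculus and positivity under embedding and partial trace\<close>

lemma embed_op_unitary:
  assumes B: "finite B" and AB: "A \<subseteq> B" and U: "unitary_mat (hdim d A) U"
  shows "unitary_mat (hdim d B) (embed_op d A B U)"
  using unitary_matD[OF U]
  by (intro unitary_matI)
    (simp_all add: embed_op_adjoint[OF B AB] embed_op_mult[OF B AB, symmetric] embed_op_one[OF B AB])

lemma embed_op_real_diag:
  assumes B: "finite B" and AB: "A \<subseteq> B"
  shows "embed_op d A B (real_diag (hdim d A) l) = real_diag (hdim d B)
    (\<lambda>i. l (to_nat_on (configs d A) (restrict (from_nat_into (configs d B) i) A)))"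
proof (rule operator_eqI[OF B])
  fix x y assume x: "x \<in> configs d B" and y: "y \<in> configs d B"
  have "x = y \<longleftrightarrow> (\<forall>v\<in>B - A. x v = y v) \<and> restrict x A = restrict y A"
    using config_eqI[OF x y] by (auto simp: restrict_def fun_eq_iff)
  then show "entry d B (embed_op d A B (real_diag (hdim d A) l)) x y = entry d B (real_diag (hdim d B)
    (\<lambda>i. l (to_nat_on (configs d A) (restrict (from_nat_into (configs d B) i) A)))) x y"
    using B x y AB finite_subset[OF AB B] by (auto simp: entry_embed_op entry_real_diag restrict_config)
qed simp_all

lemma embed_op_conj_real_diag:
  assumes B: "finite B" and AB: "A \<subseteq> B" and U: "unitary_mat (hdim d A) U"
  shows "embed_op d A B (U * real_diag (hdim d A) l * mat_adjoint U) =
    embed_op d A B U * embed_op d A B (real_diag (hdim d A) l) * mat_adjoint (embed_op d A B U)"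
  using unitary_matD[OF U] by (simp add: embed_op_adjoint[OF B AB] embed_op_mult[OF B AB])

text \<open>Embedding respects products and adjoints and keeps real diagonals diagonal, so it
  carries a diagonalization of \<open>M\<close> to one of the embedded operator.\<close>

lemma spectral_fun_embed_op:
  assumes B: "finite B" and AB: "A \<subseteq> B" and M: "hermitian (hdim d A) M"
  shows "spectral_fun f (embed_op d A B M) = embed_op d A B (spectral_fun f M)"
proof -
  obtain U l where U: "unitary_mat (hdim d A) U" and MU: "M = U * real_diag (hdim d A) l * mat_adjoint U"
    using hermitian_obtain[OF M] .
  show ?thesis
    unfolding spectral_fun_eq[OF U MU]
    unfolding MU embed_op_conj_real_diag[OF B AB U] embed_op_real_diag[OF B AB]
    by (rule spectral_fun_eq[OF embed_op_unitary[OF B AB U] refl])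
qed

lemma pos_def_embed_op:
  assumes B: "finite B" and AB: "A \<subseteq> B" and M: "pos_def (hdim d A) M"
  shows "pos_def (hdim d B) (embed_op d A B M)"
proof -
  obtain U l where U: "unitary_mat (hdim d A) U" and MU: "M = U * real_diag (hdim d A) l * mat_adjoint U"
    and l: "\<And>i. i < hdim d A \<Longrightarrow> 0 < l i" using pos_def_obtain[OF M] by metis
  have A: "finite A" using finite_subset[OF AB B] .
  show ?thesis
    unfolding MU embed_op_conj_real_diag[OF B AB U] embed_op_real_diag[OF B AB]
    by (rule pos_def_conj_real_diag[OF embed_op_unitary[OF B AB U]])
      (auto intro!: l config_number_less[OF A] restrict_config[OF _ AB] config_number_of[OF B])
qed

text \<open>The quadratic form in configuration coordinates, where \<open>sum_configs_split\<close>
  can separate \<open>A\<close> from the traced part.\<close>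

definition quad_form :: "('v \<Rightarrow> nat) \<Rightarrow> 'v set \<Rightarrow> complex mat \<Rightarrow> (('v \<Rightarrow> nat) \<Rightarrow> complex) \<Rightarrow> complex" where
  "quad_form d A M g = (\<Sum>x\<in>configs d A. \<Sum>y\<in>configs d A. entry d A M x y * g y * cnj (g x))"

lemma quad_form_inner:
  assumes A: "finite A" and M: "M \<in> carrier_mat (hdim d A) (hdim d A)"
    and v: "v \<in> carrier_vec (hdim d A)"
  shows "(M *\<^sub>v v) \<bullet>c v = quad_form d A M (\<lambda>x. v $ to_nat_on (configs d A) x)"
  using M v unfolding quad_form_def entry_def scalar_prod_def
  by (simp add: scalar_prod_def atLeast0LessThan sum_config_number[OF A] sum_distrib_right config_number_less[OF A])

lemma quad_form_pos:
  assumes A: "finite A" and M: "pos_def (hdim d A) M" and x: "x \<in> configs d A" "g x \<noteq> 0"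
  shows "0 < Re (quad_form d A M g)"
proof -
  define v where "v = vec (hdim d A) (\<lambda>i. g (from_nat_into (configs d A) i))"
  have v: "v \<in> carrier_vec (hdim d A)" by (simp add: v_def)
  have vg: "v $ to_nat_on (configs d A) y = g y" if "y \<in> configs d A" for y
    using A that by (simp add: v_def config_number_less)
  have "v \<noteq> 0\<^sub>v (hdim d A)"
    using vg[OF x(1)] x config_number_less[OF A x(1)] by auto
  then have "0 < Re ((M *\<^sub>v v) \<bullet>c v)" using M v unfolding pos_def_def by blast
  also have "(M *\<^sub>v v) \<bullet>c v = quad_form d A M g"
    unfolding quad_form_inner[OF A pos_def_carrier[OF M] v] quad_form_def by (simp add: vg)
  finally show ?thesis .
qed

text \<open>The form of the partial trace at \<open>g\<close> is the sum over \<open>z\<close> of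
  the forms of \<open>M\<close> at \<open>g\<close> tensored with the basis vector
  \<open>z\<close>.\<close>

lemma pos_def_ptrace:
  assumes B: "finite B" and AB: "A \<subseteq> B" and pos: "\<And>v. v \<in> B \<Longrightarrow> 0 < d v" and M: "pos_def (hdim d B) M"
  shows "pos_def (hdim d A) (ptrace d B A M)"
  unfolding pos_def_def
proof (intro conjI ballI impI)
  have A: "finite A" using finite_subset[OF AB B] .
  show "mat_adjoint (ptrace d B A M) = ptrace d B A M"
    using M by (simp add: ptrace_adjoint[OF B AB] pos_def_def)
  fix v :: "complex vec" assume v: "v \<in> carrier_vec (hdim d A)" "v \<noteq> 0\<^sub>v (hdim d A)"
  define g where "g x = v $ to_nat_on (configs d A) x" for x
  \<comment> \<open>\<open>h z\<close> is \<open>g\<close> tensored with the basis vector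
    \<open>z\<close> off \<open>A\<close>.\<close>
  define h where "h z w = (if restrict w (B - A) = z then g (restrict w A) else 0)" for z w
  obtain i where i: "i < hdim d A" "v $ i \<noteq> 0" using v by (metis carrier_vecD eq_vecI index_zero_vec)
  define x0 where "x0 = from_nat_into (configs d A) i"
  have x0: "x0 \<in> configs d A" "g x0 \<noteq> 0"
    using config_number_of[OF A i(1)] i(2) by (simp_all add: x0_def g_def)
  have hg: "h z (override_on z' x A) = (if z' = z then g x else 0)"
    if "x \<in> configs d A" "z' \<in> configs d (B - A)" for x z z'
    using that by (simp add: h_def restrict_glue_left restrict_glue_right)
  have slice: "quad_form d B M (h z) = (\<Sum>x\<in>configs d A. \<Sum>y\<in>configs d A.
      entry d B M (override_on z x A) (override_on z y A) * g y * cnj (g x))"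
    if z: "z \<in> configs d (B - A)" for z
  proof -
    have inner: "(\<Sum>w\<in>configs d B. f w * h z w) = (\<Sum>y\<in>configs d A. f (override_on z y A) * g y)" for f
    proof -
      have "(\<Sum>w\<in>configs d B. f w * h z w)
          = (\<Sum>y\<in>configs d A. \<Sum>z'\<in>configs d (B - A). if z' = z then f (override_on z y A) * g y else 0)"
        unfolding sum_configs_split[OF AB] by (intro sum.cong) (auto simp: hg)
      then show ?thesis using B z by simp
    qed
    have innerc: "(\<Sum>w\<in>configs d B. f w * cnj (h z w)) = (\<Sum>y\<in>configs d A. f (override_on z y A) * cnj (g y))" for f
      using arg_cong[OF inner[of "\<lambda>w. cnj (f w)"], of cnj] by simp
    show ?thesis
      unfolding quad_form_def by (simp add: inner innerc sum_distrib_right[symmetric])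
  qed
  have "(ptrace d B A M *\<^sub>v v) \<bullet>c v = quad_form d A (ptrace d B A M) g"
    unfolding g_def by (rule quad_form_inner[OF A _ v(1)]) simp
  also have "\<dots> = (\<Sum>x\<in>configs d A. \<Sum>y\<in>configs d A. \<Sum>z\<in>configs d (B - A).
      entry d B M (override_on z x A) (override_on z y A) * g y * cnj (g x))"
    unfolding quad_form_def by (simp add: entry_ptrace[OF A] sum_distrib_right)
  also have "\<dots> = (\<Sum>x\<in>configs d A. \<Sum>z\<in>configs d (B - A). \<Sum>y\<in>configs d A.
      entry d B M (override_on z x A) (override_on z y A) * g y * cnj (g x))"
    by (intro sum.cong refl sum.swap)
  also have "\<dots> = (\<Sum>z\<in>configs d (B - A). quad_form d B M (h z))"
    by (subst sum.swap) (simp add: slice)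
  finally have eq: "(ptrace d B A M *\<^sub>v v) \<bullet>c v = (\<Sum>z\<in>configs d (B - A). quad_form d B M (h z))" .
  have hpos: "0 < Re (quad_form d B M (h z))" if z: "z \<in> configs d (B - A)" for z
    using x0 z by (intro quad_form_pos[OF B M glue_config[OF x0(1) z AB]]) (simp add: hg)
  \<comment> \<open>Strict positivity requires at least one summand.\<close>
  have ne: "configs d (B - A) \<noteq> {}" using configs_nonempty[of "B - A" d] pos by auto
  show "0 < Re ((ptrace d B A M *\<^sub>v v) \<bullet>c v)"
    unfolding eq using B ne hpos by (auto intro!: sum_pos)
qed simp

section \<open>Entropies and conditional independence from a factorization\<close>

lemma mtrace_add:
  "A \<in> carrier_mat n n \<Longrightarrow> B \<in> carrier_mat n n \<Longrightarrow> mtrace (A + B) = mtrace A + mtrace B"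
  by (auto simp: mtrace_def sum.distrib)

lemma hdim_empty: "hdim d {} = 1"
  by (simp add: hdim_def configs_def)

text \<open>Writes the entropy of any subset of \<open>W\<close> as a trace against the same
  marginal on \<open>W\<close>, so that entropies can be combined by linearity.\<close>

lemma entropy_eq:
  assumes V: "finite V" and W: "W \<subseteq> V" and A: "A \<subseteq> W" and pos: "\<And>v. v \<in> V \<Longrightarrow> 0 < d v"
    and st: "pd_state d V \<omega>"
  shows "entropy d V \<omega> A =
    - Re (mtrace (marg d V \<omega> W * spectral_fun ln (embed_op d A W (marg d V \<omega> A))))"
proof -
  have fin: "finite W" "finite A" using V W A by (auto intro: finite_subset)
  have \<omega>: "pos_def (hdim d V) \<omega>" "mtrace \<omega> = 1" using st by (auto simp: pd_state_def)
  have pd: "pos_def (hdim d A) (marg d V \<omega> A)"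
    unfolding marg_def using V W A pos \<omega> by (intro pos_def_ptrace) auto
  note h = pos_def_hermitian[OF pd]
  have "marg d V \<omega> A = ptrace d W A (marg d V \<omega> W)"
    unfolding marg_def using V W A by (simp add: ptrace_ptrace)
  then have "mtrace (marg d V \<omega> A * spectral_fun ln (marg d V \<omega> A))
      = mtrace (marg d V \<omega> W * embed_op d A W (spectral_fun ln (marg d V \<omega> A)))"
    using mtrace_ptrace_mult[OF fin(1) A, of "marg d V \<omega> W" d "spectral_fun ln (marg d V \<omega> A)"]
      hermitian_carrier[OF hermitian_spectral_fun[OF h]] by (simp add: marg_def)
  then have eq: "mtrace (marg d V \<omega> A * spectral_fun ln (marg d V \<omega> A))
      = mtrace (marg d V \<omega> W * spectral_fun ln (embed_op d A W (marg d V \<omega> A)))"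
    by (simp add: spectral_fun_embed_op[OF fin(1) A h])
  show ?thesis
  proof (cases "A = {}")
    \<comment> \<open>The convention 0 agrees with the formula: the marginal on the empty set is the
      scalar 1 by normalization, and \<open>ln 1 = 0\<close>.\<close>
    case True
    have c: "marg d V \<omega> {} \<in> carrier_mat 1 1" unfolding marg_def using ptrace_carrier[of d V "{}" \<omega>] by (simp add: hdim_empty)
    have "mtrace (marg d V \<omega> {}) = 1"
      unfolding marg_def using mtrace_ptrace[OF V, of "{}" \<omega> d] pos_def_carrier[OF \<omega>(1)] \<omega>(2) by simp
    then have "marg d V \<omega> {} = 1\<^sub>m 1"
      using c by (intro eq_matI) (auto simp: mtrace_def)
    moreover have "spectral_fun ln (1\<^sub>m 1) = real_diag 1 (\<lambda>_. ln 1)"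
    proof -
      have u: "unitary_mat 1 (1\<^sub>m 1)" by (simp add: unitary_mat_def)
      have "(1\<^sub>m 1 :: complex mat) = 1\<^sub>m 1 * real_diag 1 (\<lambda>_. 1) * mat_adjoint (1\<^sub>m 1)"
        by (intro eq_matI) (auto simp: index_real_diag)
      from spectral_fun_eq[OF u this, of ln] show ?thesis by simp
    qed
    ultimately have "mtrace (marg d V \<omega> {} * spectral_fun ln (marg d V \<omega> {})) = 0"
      by (simp add: mtrace_def index_real_diag)
    then show ?thesis using eq True by (simp add: entropy_def)
  next
    case False
    then show ?thesis using eq by (simp add: entropy_def)
  qed
qed

lemma q_indep_of_factorization:
  assumes V: "finite V" and pos: "\<And>v. v \<in> V \<Longrightarrow> 0 < d v" and st: "pd_state d V \<omega>"
    and W: "C \<union> D = W" "W \<subseteq> V" and S: "C \<inter> D = S" and A: "A \<subseteq> C" and B: "B \<subseteq> D"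
    and F: "pos_def (hdim d C) F" and G: "pos_def (hdim d D) G"
    and FG: "marg d V \<omega> W = embed_op d C W F * embed_op d D W G"
    and GF: "marg d V \<omega> W = embed_op d D W G * embed_op d C W F"
  shows "q_indep d V \<omega> A B S"
proof -
  have fin: "finite W" "finite C" "finite D" using V W by (auto intro: finite_subset)
  have posW: "\<And>v. v \<in> W \<Longrightarrow> 0 < d v" using pos W by auto
  note Fc = pos_def_carrier[OF F] and Gc = pos_def_carrier[OF G]
  \<comment> \<open>The largest set in the mutual information; all logarithms are taken on its
    space.\<close>
  define W0 where "W0 = A \<union> B \<union> S"
  have W0: "W0 \<subseteq> W" "finite W0" using A B S W fin by (auto simp: W0_def intro: finite_subset)
  define f where "f T = embed_op d T W0 (ptrace d C T F)" for T
  define g where "g T = embed_op d T W0 (ptrace d D T G)" for T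
  have pdf: "pos_def (hdim d W0) (f T)" if "T \<subseteq> C" "T \<subseteq> W0" for T
    unfolding f_def using that W fin posW F W0 by (intro pos_def_embed_op pos_def_ptrace) auto
  have pdg: "pos_def (hdim d W0) (g T)" if "T \<subseteq> D" "T \<subseteq> W0" for T
    unfolding g_def using that W fin posW G W0 by (intro pos_def_embed_op pos_def_ptrace) auto
  \<comment> \<open>Both orders of the product on \<open>W\<close> are reduced, which shows that the
    reductions \<open>f\<close> and \<open>g\<close> commute.\<close>
  have margT: "embed_op d T W0 (marg d V \<omega> T) = f (C \<inter> T) * g (D \<inter> T)
      \<and> embed_op d T W0 (marg d V \<omega> T) = g (D \<inter> T) * f (C \<inter> T)"
    if T: "S \<subseteq> T" "T \<subseteq> W0" for T
  proof -
    have TW: "T \<subseteq> W" using T W0 by auto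
    have m: "marg d V \<omega> T = ptrace d W T (marg d V \<omega> W)"
      unfolding marg_def using V W TW by (simp add: ptrace_ptrace)
    have 1: "marg d V \<omega> T = embed_op d (C \<inter> T) T (ptrace d C (C \<inter> T) F) * embed_op d (D \<inter> T) T (ptrace d D (D \<inter> T) G)"
      unfolding m FG using ptrace_mult_both[OF fin(1) W(1) _ TW Fc Gc] S T by simp
    have "D \<union> C = W" "D \<inter> C \<subseteq> T" using W S T by auto
    then have 2: "marg d V \<omega> T = embed_op d (D \<inter> T) T (ptrace d D (D \<inter> T) G) * embed_op d (C \<inter> T) T (ptrace d C (C \<inter> T) F)"
      unfolding m GF using ptrace_mult_both[OF fin(1) _ _ TW Gc Fc] by simp
    have 3: "embed_op d T W0 (embed_op d P T X * embed_op d R T Y) = embed_op d P W0 X * embed_op d R W0 Y"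
      if "P \<subseteq> T" "R \<subseteq> T" for P R X Y
      using that by (simp add: embed_op_mult[OF W0(2) T(2)] embed_op_embed_op[OF W0(2) _ T(2)])
    have "embed_op d T W0 (marg d V \<omega> T) = f (C \<inter> T) * g (D \<inter> T)"
      unfolding 1 f_def g_def by (rule 3) auto
    moreover have "embed_op d T W0 (marg d V \<omega> T) = g (D \<inter> T) * f (C \<inter> T)"
      unfolding 2 f_def g_def by (rule 3) auto
    ultimately show ?thesis ..
  qed
  define \<Omega> where "\<Omega> = marg d V \<omega> W0"
  have \<Omega>c: "\<Omega> \<in> carrier_mat (hdim d W0) (hdim d W0)" by (simp add: \<Omega>_def marg_def)
  define L where "L M = Re (mtrace (\<Omega> * spectral_fun ln M))" for M
  have ent: "entropy d V \<omega> T = - (L (f (C \<inter> T)) + L (g (D \<inter> T)))" if T: "S \<subseteq> T" "T \<subseteq> W0" for T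
  proof -
    note pf = pdf[of "C \<inter> T"] and pg = pdg[of "D \<inter> T"]
    have pd: "pos_def (hdim d W0) (f (C \<inter> T))" "pos_def (hdim d W0) (g (D \<inter> T))"
      using pf pg T by auto
    have comm: "f (C \<inter> T) * g (D \<inter> T) = g (D \<inter> T) * f (C \<inter> T)" using margT[OF T] by metis
    have sc: "spectral_fun ln (f (C \<inter> T)) \<in> carrier_mat (hdim d W0) (hdim d W0)"
      "spectral_fun ln (g (D \<inter> T)) \<in> carrier_mat (hdim d W0) (hdim d W0)"
      using pd by (auto intro: hermitian_carrier hermitian_spectral_fun pos_def_hermitian)
    have "entropy d V \<omega> T = - L (f (C \<inter> T) * g (D \<inter> T))"
      unfolding L_def \<Omega>_def using entropy_eq[OF V _ T(2) pos st] W0 W margT[OF T] by simp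
    also have "\<dots> = - (L (f (C \<inter> T)) + L (g (D \<inter> T)))"
      unfolding L_def ln_commuting_mult[OF pd comm] using \<Omega>c sc
      by (simp add: mult_add_distrib_mat[where nr = "hdim d W0" and n = "hdim d W0" and nc = "hdim d W0"]
          mtrace_add[where n = "hdim d W0"])
    finally show ?thesis .
  qed
  \<comment> \<open>The term from \<open>F\<close> depends on \<open>T\<close> only through
    \<open>C \<inter> T\<close>, which is the same for \<open>A \<union> S\<close> and
    \<open>W0\<close>, and for \<open>B \<union> S\<close> and \<open>S\<close>. For
    \<open>G\<close> the roles of \<open>A\<close> and \<open>B\<close> are exchanged.\<close>
  have sets: "C \<inter> (A \<union> S) = A \<union> S" "D \<inter> (A \<union> S) = S" "C \<inter> (B \<union> S) = S" "D \<inter> (B \<union> S) = B \<union> S"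
    "C \<inter> S = S" "D \<inter> S = S" "C \<inter> W0 = A \<union> S" "D \<inter> W0 = B \<union> S"
    using A B S by (auto simp: W0_def)
  have "entropy d V \<omega> (A \<union> S) + entropy d V \<omega> (B \<union> S) - entropy d V \<omega> S - entropy d V \<omega> W0 = 0"
  proof -
    have sub: "A \<union> S \<subseteq> W0" "B \<union> S \<subseteq> W0" "S \<subseteq> W0" by (auto simp: W0_def)
    show ?thesis
      using ent[OF _ sub(1)] ent[OF _ sub(2)] ent[OF _ sub(3)] ent[OF sub(3) order.refl] unfolding sets by simp
  qed
  then show ?thesis by (simp add: q_indep_def cond_mutual_info_def W0_def)
qed

section \<open>d-separation\<close>

text \<open>\<open>reach E S A v b\<close>: some walk from \<open>A\<close> to \<open>v\<close> is active up to its last vertex; \<open>b\<close> tells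
  whether its last step enters \<open>v\<close> along an arrow, which decides if a further step against an
  arrow makes \<open>v\<close> a collider.\<close>

inductive reach :: "('v \<times> 'v) set \<Rightarrow> 'v set \<Rightarrow> 'v set \<Rightarrow> 'v \<Rightarrow> bool \<Rightarrow> bool" for E S A where
  start: "a \<in> A \<Longrightarrow> reach E S A a False"
| down: "reach E S A v b \<Longrightarrow> v \<notin> S \<Longrightarrow> (v, x) \<in> E \<Longrightarrow> reach E S A x True"
| up: "reach E S A v b \<Longrightarrow> b \<longleftrightarrow> v \<in> S \<Longrightarrow> (x, v) \<in> E \<Longrightarrow> reach E S A x False"

text \<open>The last position is exempt: whether it is a collider depends on the next step. The flag
  \<open>b\<close> keeps what that decision needs.\<close>

definition active_until :: "'v set \<Rightarrow> ('v \<times> 'v) set \<Rightarrow> 'v set \<Rightarrow> 'v set \<Rightarrow> 'v list \<Rightarrow> bool \<Rightarrow> bool" where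
  "active_until V E S A p b \<longleftrightarrow> walk V E p \<and> hd p \<in> A \<and>
     (\<forall>i. Suc i < length p \<longrightarrow> (if collider_at E p i then p ! i \<in> S else p ! i \<notin> S)) \<and>
     (b \<longleftrightarrow> 2 \<le> length p \<and> (p ! (length p - 2), last p) \<in> E)"

lemma dag_asym: "dag V E \<Longrightarrow> (u, v) \<in> E \<Longrightarrow> (v, u) \<notin> E"
  unfolding dag_def by (meson acyclic_def r_into_trancl trancl_into_trancl)

text \<open>Appending \<open>x\<close> changes the status of one position only, the former endpoint,
  and the last assumption is the activity condition there.\<close>

lemma active_until_step:
  assumes p: "active_until V E S A p b" and x: "x \<in> V" "(last p, x) \<in> E \<or> (x, last p) \<in> E"
    and S: "if b \<and> (x, last p) \<in> E then last p \<in> S else last p \<notin> S"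
  shows "active_until V E S A (p @ [x]) ((last p, x) \<in> E)"
proof -
  have ne: "p \<noteq> []" using p by (simp add: active_until_def walk_def)
  let ?n = "length p"
  have lst: "last p = p ! (?n - 1)" using ne by (rule last_conv_nth)
  have "walk V E (p @ [x])"
    unfolding walk_def
  proof (intro conjI allI impI)
    fix i assume i: "Suc i < length (p @ [x])"
    show "((p @ [x]) ! i, (p @ [x]) ! Suc i) \<in> E \<or> ((p @ [x]) ! Suc i, (p @ [x]) ! i) \<in> E"
    proof (cases "Suc i < ?n")
      case True
      then show ?thesis using p by (auto simp: active_until_def walk_def nth_append)
    next
      case False
      then have "i = ?n - 1" "Suc i = ?n" using i by auto
      then show ?thesis using x(2) lst ne by (simp add: nth_append)
    qed
  qed (use p x ne in \<open>auto simp: active_until_def walk_def\<close>)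
  moreover have "if collider_at E (p @ [x]) i then (p @ [x]) ! i \<in> S else (p @ [x]) ! i \<notin> S"
    if i: "Suc i < length (p @ [x])" for i
  proof (cases "Suc i < ?n")
    case True
    then have "collider_at E (p @ [x]) i = collider_at E p i"
      by (auto simp: collider_at_def nth_append)
    then show ?thesis using p True by (auto simp: active_until_def nth_append)
  next
    case False
    then have i': "i = ?n - 1" "Suc i = ?n" "i < ?n" using i by auto
    \<comment> \<open>A collider needs an arrow into the vertex on both sides: \<open>b\<close>
      records the earlier step, \<open>x\<close> supplies the new one.\<close>
    have "collider_at E (p @ [x]) i \<longleftrightarrow> b \<and> (x, last p) \<in> E"
      using p i' by (auto simp: collider_at_def nth_append active_until_def lst numeral_2_eq_2 Suc_le_eq)
    moreover have "(p @ [x]) ! i = last p" using i' lst by (simp add: nth_append)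
    ultimately show ?thesis using S by simp
  qed
  moreover have "(p @ [x]) ! (length (p @ [x]) - 2) = last p" "2 \<le> length (p @ [x])" "hd (p @ [x]) \<in> A"
    using p ne lst by (auto simp: active_until_def nth_append Suc_le_eq numeral_2_eq_2)
  ultimately show ?thesis
    unfolding active_until_def by simp
qed

text \<open>Realizes the states of \<open>reach\<close> by walks. No arrow runs in both directions,
  so the flag of the walk is the recorded one.\<close>

lemma reach_walk:
  assumes "dag V E" "A \<subseteq> V" "reach E S A v b"
  shows "\<exists>p. active_until V E S A p b \<and> last p = v"
  using assms(3)
proof induction
  case (start a)
  then have "active_until V E S A [a] False"
    using assms(2) by (auto simp: active_until_def walk_def)
  then show ?case by (metis last.simps)
next
  case (down v b x)
  then obtain p where p: "active_until V E S A p b" "last p = v" by blast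
  have "x \<in> V" "(x, v) \<notin> E"
    using down.hyps assms(1) dag_asym[OF assms(1) down.hyps(3)] by (auto simp: dag_def)
  with active_until_step[OF p(1), of x] p(2) down.hyps
  have "active_until V E S A (p @ [x]) True" by simp
  then show ?case by (metis last_snoc)
next
  case (up v b x)
  then obtain p where p: "active_until V E S A p b" "last p = v" by blast
  have "x \<in> V" "(v, x) \<notin> E"
    using up.hyps assms(1) dag_asym[OF assms(1) up.hyps(3)] by (auto simp: dag_def)
  with active_until_step[OF p(1), of x] p(2) up.hyps
  have "active_until V E S A (p @ [x]) False" by simp
  then show ?case by (metis last_snoc)
qed

text \<open>As an endpoint \<open>v\<close> is a non-collider, so \<open>v \<notin> S\<close>
  completes the activity of the walk.\<close>

lemma d_separated_not_reach:
  assumes "dag V E" "A \<subseteq> V" "d_separated V E A B S" "reach E S A v b" "v \<notin> S"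
  shows "v \<notin> B"
proof
  assume "v \<in> B"
  obtain p where p: "active_until V E S A p b" "last p = v"
    using reach_walk[OF assms(1,2,4)] by blast
  have ne: "p \<noteq> []" using p by (simp add: active_until_def walk_def)
  have "active E p S"
    unfolding active_def
  proof (intro allI impI)
    fix i assume i: "i < length p"
    show "if collider_at E p i then p ! i \<in> S else p ! i \<notin> S"
    proof (cases "Suc i < length p")
      case False
      then have "i = length p - 1" using i by simp
      then have "p ! i = v" "\<not> collider_at E p i"
        using p(2) ne by (auto simp: last_conv_nth collider_at_def)
      then show ?thesis using assms(5) by simp
    qed (use p in \<open>auto simp: active_until_def\<close>)
  qed
  then show False
    using assms(3) p \<open>v \<in> B\<close> unfolding d_separated_def active_until_def by blast
qed

text \<open>Walk down to \<open>S\<close> and back up; the vertex of \<open>S\<close> becomes a collider.\<close>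

lemma reach_bounce:
  assumes "(v, s) \<in> E\<^sup>*" "s \<in> S" "reach E S A v b" "v \<notin> S"
  shows "reach E S A v False"
  using assms(1,3,4)
proof (induction arbitrary: b rule: converse_rtrancl_induct)
  case base
  then show ?case using assms(2) by simp
next
  case (step v w)
  then have w: "reach E S A w True" by (blast intro: reach.down)
  show ?case
  \<comment> \<open>\<open>w\<close> was entered along an arrow: inside \<open>S\<close> it may
    serve as a collider at once, outside \<open>S\<close> the bounce happens further down.\<close>
  proof (cases "w \<in> S")
    case True
    then show ?thesis using w step.hyps(1) by (auto intro: reach.up)
  next
    case False
    then have "reach E S A w False" using step.IH w by blast
    then show ?thesis using False step.hyps(1) by (auto intro: reach.up)
  qed
qed

text \<open>Climb from \<open>a\<close> to \<open>v\<close> against the arrows. Every vertex on the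
  path descends from \<open>v\<close>, hence avoids \<open>S\<close>.\<close>

lemma reach_ancestor:
  assumes "(v, a) \<in> E\<^sup>*" "a \<in> A" "\<And>s. s \<in> S \<Longrightarrow> (v, s) \<notin> E\<^sup>*"
  shows "reach E S A v False"
  using assms(1,3)
proof (induction rule: converse_rtrancl_induct)
  case base
  show ?case using assms(2) by (rule reach.start)
next
  case (step v w)
  have "reach E S A w False" using step by (meson converse_rtrancl_into_rtrancl)
  moreover have "w \<notin> S" using step by blast
  ultimately show ?case using step.hyps(1) by (auto intro: reach.up)
qed

text \<open>Descend along the path; all its vertices avoid \<open>S\<close>, so none blocks.\<close>

lemma reach_descendant:
  assumes "(v, t) \<in> E\<^sup>*" "reach E S A v b" "\<And>s. s \<in> S \<Longrightarrow> (v, s) \<notin> E\<^sup>*"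
  shows "\<exists>b. reach E S A t b"
  using assms
proof (induction rule: rtrancl_induct)
  case (step t u)
  have "t \<notin> S" using step by blast
  with step show ?case by (blast intro: reach.down)
qed blast

definition ancestral :: "('v \<times> 'v) set \<Rightarrow> 'v set \<Rightarrow> bool" where
  "ancestral E W \<longleftrightarrow> (\<forall>v\<in>W. pa E v \<subseteq> W)"

text \<open>\<open>C\<close> consists of \<open>S\<close> and of the vertices that an active walk from \<open>A\<close> can reach.\<close>

lemma d_separated_split:
  assumes dag: "dag V E" and sub: "A \<subseteq> V" "B \<subseteq> V" "S \<subseteq> V"
    and disj: "A \<inter> B = {}" "A \<inter> S = {}" "B \<inter> S = {}" and dsep: "d_separated V E A B S"
  shows "\<exists>C D. C \<union> D \<subseteq> V \<and> ancestral E (C \<union> D) \<and> C \<inter> D = S \<and> A \<subseteq> C \<and> B \<subseteq> D \<and>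
    (\<forall>u\<in>C \<union> D. family E u \<subseteq> C \<or> family E u \<subseteq> D)"
proof -
  define W where "W = {u. \<exists>t\<in>A \<union> B \<union> S. (u, t) \<in> E\<^sup>*}"
  have WV: "W \<subseteq> V"
  proof
    fix u assume "u \<in> W"
    then obtain t where "t \<in> V" "(u, t) \<in> E\<^sup>*" using sub by (auto simp: W_def)
    then show "u \<in> V" using dag by (auto simp: dag_def elim: converse_rtranclE)
  qed
  have anc: "pa E v \<subseteq> W" if "v \<in> W" for v
    using that by (auto simp: W_def pa_def intro: converse_rtrancl_into_rtrancl)
  have ABS: "A \<union> B \<union> S \<subseteq> W" by (auto simp: W_def)
  define R where "R = {v \<in> W - S. \<exists>b. reach E S A v b}"
  \<comment> \<open>A reached vertex outside \<open>S\<close> can also be reached with flag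
    \<open>False\<close>, hence left against an arrow. It lies above \<open>S\<close> (bounce),
    above \<open>A\<close> (climb from there), or above \<open>B\<close>; the last would give an
    active walk to \<open>B\<close>.\<close>
  have RF: "reach E S A v False" if v: "v \<in> W - S" "reach E S A v b" for v b
  proof (cases "\<exists>s\<in>S. (v, s) \<in> E\<^sup>*")
    case True
    then show ?thesis using v reach_bounce by fast
  next
    case False
    then obtain t where t: "t \<in> A \<union> B" "(v, t) \<in> E\<^sup>*" using v by (auto simp: W_def)
    show ?thesis
    proof (cases "t \<in> A")
      case True
      then show ?thesis using t False by (intro reach_ancestor) auto
    next
      case tA: False
      obtain b' where "reach E S A t b'" using reach_descendant[OF t(2) v(2)] False by blast
      with d_separated_not_reach[OF dag sub(1) dsep this] show ?thesis using t tA disj by auto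
    qed
  qed
  \<comment> \<open>The moral graph step: reachability spreads from one member of a family to every
    other member outside \<open>S\<close>.\<close>
  have moral: "y \<in> R" if u: "u \<in> W" and x: "x \<in> R" "x \<in> family E u" and y: "y \<in> family E u" "y \<notin> S" for u x y
  proof -
    have yW: "y \<in> W" using anc[OF u] u y by auto
    have xF: "reach E S A x False" and xS: "x \<notin> S" using x(1) RF by (auto simp: R_def)
    have uF: "reach E S A y False" if "reach E S A u False" "u \<notin> S" "y \<noteq> u"
      using that y by (auto simp: pa_def intro: reach.up)
    show ?thesis
    proof (cases "x = u")
      case True
      then show ?thesis using uF xF xS yW y x(1) by (cases "y = u") (auto simp: R_def)
    next
      case False
      then have u': "reach E S A u True" using x(2) xF xS by (auto simp: pa_def intro: reach.down)
      \<comment> \<open>\<open>x\<close> is a parent of \<open>u\<close>. The walk stops at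
        \<open>u\<close>, turns there at a collider in \<open>S\<close>, or passes on to
        \<open>y\<close> after \<open>RF\<close> has reset the flag.\<close>
      consider "y = u" | "y \<noteq> u" "u \<in> S" | "y \<noteq> u" "u \<notin> S" by blast
      then have "\<exists>b. reach E S A y b"
      proof cases
        case 1
        then show ?thesis using u' by blast
      next
        case 2
        then have "(y, u) \<in> E" using y by (auto simp: pa_def)
        then show ?thesis using reach.up[OF u'] 2 by blast
      next
        case 3
        then show ?thesis using uF RF[OF _ u'] u by blast
      qed
      then show ?thesis using yW y by (auto simp: R_def)
    qed
  qed
  let ?C = "R \<union> S" and ?D = "W - R"
  have CD: "?C \<union> ?D = W" "?C \<inter> ?D = S" using ABS by (auto simp: R_def)
  have "A \<subseteq> ?C" using ABS disj by (auto simp: R_def intro: reach.start)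
  moreover have "B \<subseteq> ?D"
    using ABS disj d_separated_not_reach[OF dag sub(1) dsep] by (auto simp: R_def)
  moreover have "family E u \<subseteq> ?C \<or> family E u \<subseteq> ?D" if u: "u \<in> W" for u
  proof (cases "\<exists>x \<in> family E u. x \<in> R")
    case True
    then show ?thesis using moral[OF u] by blast
  next
    case False
    then show ?thesis using anc[OF u] u by blast
  qed
  ultimately show ?thesis
    using WV anc CD unfolding ancestral_def by (intro exI[of _ ?C] exI[of _ ?D]) auto
qed

section \<open>Commuting kernels\<close>

lemma ex_sorted_enumeration:
  assumes "finite A" "A \<subseteq> V" "strict_linear_order_on V r"
  shows "\<exists>vs. distinct vs \<and> set vs = A \<and> sorted_wrt (\<lambda>u w. (u, w) \<in> r) vs"
  using assms(1,2)
proof (induction rule: finite_induct)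
  case (insert a A)
  then obtain vs where vs: "distinct vs" "set vs = A" "sorted_wrt (\<lambda>u w. (u, w) \<in> r) vs" by auto
  have tr: "trans r" and irr: "irrefl r" and tot: "total_on V r"
    using assms(3) by (auto simp: strict_linear_order_on_def)
  let ?ws = "filter (\<lambda>u. (u, a) \<in> r) vs @ a # filter (\<lambda>u. (a, u) \<in> r) vs"
  have asym: "(a, u) \<notin> r" if "(u, a) \<in> r" for u
    using that tr irr by (auto simp: irrefl_def dest: transD)
  have "distinct ?ws" using vs insert.hyps asym by auto
  moreover have "set ?ws = insert a A"
    using vs tot insert.prems insert.hyps by (auto simp: total_on_def)
  moreover have "sorted_wrt (\<lambda>u w. (u, w) \<in> r) ?ws"
    using vs by (auto simp: sorted_wrt_append sorted_wrt_filter intro: transD[OF tr])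
  ultimately show ?case by blast
qed auto

lemma sorted_enumeration_unique:
  assumes "trans r" "irrefl r"
  shows "distinct xs \<Longrightarrow> distinct ys \<Longrightarrow> set xs = set ys \<Longrightarrow>
    sorted_wrt (\<lambda>u w. (u, w) \<in> r) xs \<Longrightarrow> sorted_wrt (\<lambda>u w. (u, w) \<in> r) ys \<Longrightarrow> xs = ys"
proof (induction xs arbitrary: ys)
  case (Cons x xs)
  then obtain y ys' where ys: "ys = y # ys'" by (cases ys) auto
  have asym: "(u, w) \<in> r \<Longrightarrow> (w, u) \<notin> r" for u w
    using assms by (auto simp: irrefl_def dest: transD)
  have "x = y"
  proof (rule ccontr)
    assume "x \<noteq> y"
    then have "x \<in> set ys'" "y \<in> set xs" using Cons.prems(3) unfolding ys by auto
    then have "(y, x) \<in> r" "(x, y) \<in> r" using Cons.prems(4,5) unfolding ys by auto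
    then show False using asym by blast
  qed
  moreover have "xs = ys'" using Cons.prems \<open>x = y\<close> unfolding ys by (intro Cons.IH) auto
  ultimately show ?case using ys by simp
qed auto

text \<open>Existence and uniqueness of the sorted list give meaning to the \<open>THE\<close> in
  \<open>enumeration\<close>.\<close>

lemma enumeration_props:
  assumes "finite V" "strict_linear_order_on V r"
  shows "distinct (enumeration V r)" "set (enumeration V r) = V"
    "sorted_wrt (\<lambda>u w. (u, w) \<in> r) (enumeration V r)"
proof -
  have "\<exists>!vs. distinct vs \<and> set vs = V \<and> sorted_wrt (\<lambda>u w. (u, w) \<in> r) vs"
    using ex_sorted_enumeration[OF assms(1) order.refl assms(2)] sorted_enumeration_unique[of r] assms(2)
    unfolding strict_linear_order_on_def by metis
  from theI'[OF this] show "distinct (enumeration V r)" "set (enumeration V r) = V"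
    "sorted_wrt (\<lambda>u w. (u, w) \<in> r) (enumeration V r)"
    unfolding enumeration_def by auto
qed

lemma topological_enumeration:
  assumes "finite V" "topological_ordering V E r" "j < length (enumeration V r)"
  shows "pa E (enumeration V r ! j) \<subseteq> set (take j (enumeration V r))"
proof
  let ?vs = "enumeration V r"
  have lin: "strict_linear_order_on V r" and rV: "r \<subseteq> V \<times> V" and Er: "E \<subseteq> r"
    using assms(2) by (auto simp: topological_ordering_def)
  note vs = enumeration_props[OF assms(1) lin]
  have asym: "(u, w) \<in> r \<Longrightarrow> (w, u) \<notin> r" for u w
    using lin by (auto simp: strict_linear_order_on_def irrefl_def dest: transD)
  fix u assume "u \<in> pa E (?vs ! j)"
  then have ur: "(u, ?vs ! j) \<in> r" using Er by (auto simp: pa_def)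
  then have "u \<in> set ?vs" using rV vs(2) by auto
  then obtain i where i: "i < length ?vs" "u = ?vs ! i" by (auto simp: in_set_conv_nth)
  have "i < j"
  proof (rule ccontr)
    assume "\<not> i < j"
    then consider "i = j" | "j < i" by linarith
    then show False
    proof cases
      case 1
      then show ?thesis using ur i asym by blast
    next
      case 2
      then have "(?vs ! j, u) \<in> r" using vs(3) i by (simp add: sorted_wrt_iff_nth_less)
      then show ?thesis using ur asym by blast
    qed
  qed
  then show "u \<in> set (take j ?vs)" using i assms(3) by (auto simp: in_set_conv_nth)
qed

section \<open>Products of commuting kernels and their marginals\<close>

locale commuting_kernels =
  fixes V :: "'v set" and E :: "('v \<times> 'v) set" and d :: "'v \<Rightarrow> nat" and Q :: "'v \<Rightarrow> complex mat"
  assumes dag: "dag V E"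
    and kernels: "quantum_kernels d V E Q"
    and commute: "\<And>u v. u \<in> V \<Longrightarrow> v \<in> V \<Longrightarrow>
      embed_op d (family E u) V (Q u) * embed_op d (family E v) V (Q v) =
      embed_op d (family E v) V (Q v) * embed_op d (family E u) V (Q u)"
begin

lemma finite_V: "finite V" and finite_E: "finite E" and E_sub: "E \<subseteq> V \<times> V" and acyclic_E: "acyclic E"
  using dag by (auto simp: dag_def intro: finite_subset)

lemma family_sub: "v \<in> V \<Longrightarrow> family E v \<subseteq> V"
  using E_sub by (auto simp: pa_def)

lemma not_parent_self: "v \<notin> pa E v"
  using acyclic_E by (auto simp: pa_def acyclic_def)

lemma kernel_pos_def: "v \<in> V \<Longrightarrow> pos_def (hdim d (family E v)) (Q v)"
  and kernel_ptrace: "v \<in> V \<Longrightarrow> ptrace d (family E v) (pa E v) (Q v) = 1\<^sub>m (hdim d (pa E v))"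
  using kernels by (auto simp: quantum_kernels_def)

text \<open>The trace condition excludes a zero-dimensional factor, as its first occurrence in a
  topological order would make a partial trace vanish.\<close>

lemma dim_pos: "v \<in> V \<Longrightarrow> 0 < d v"
proof (induction v rule: wf_induct_rule[OF finite_acyclic_wf[OF finite_E acyclic_E]])
  case (1 v)
  have fin: "finite (pa E v)" using family_sub[OF 1(2)] finite_V by (auto intro: finite_subset)
  have "\<And>u. u \<in> pa E v \<Longrightarrow> 0 < d u" using 1 family_sub[OF 1(2)] by (auto simp: pa_def)
  then obtain x where x: "x \<in> configs d (pa E v)" using configs_nonempty by blast
  show ?case
  proof (rule ccontr)
    assume "\<not> 0 < d v"
    then have "configs d (family E v - pa E v) = {}"
      using not_parent_self by (auto simp: configs_def PiE_def Pi_def)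
    then have "entry d (pa E v) (ptrace d (family E v) (pa E v) (Q v)) x x = 0"
      using fin x by (simp add: entry_ptrace)
    then show False using kernel_ptrace[OF 1(2)] entry_one[OF fin x x] by simp
  qed
qed

abbreviation kernel_on :: "'v set \<Rightarrow> 'v \<Rightarrow> complex mat" where
  "kernel_on W u \<equiv> embed_op d (family E u) W (Q u)"

abbreviation product_on :: "'v set \<Rightarrow> 'v list \<Rightarrow> complex mat" where
  "product_on W us \<equiv> kernel_product d W E Q us"

text \<open>Ensures that each \<open>kernel_on W u\<close> in a product is a genuine tensoring with
  the identity.\<close>

definition supported :: "'v set \<Rightarrow> 'v list \<Rightarrow> bool" where
  "supported W us \<longleftrightarrow> W \<subseteq> V \<and> set us \<subseteq> V \<and> (\<forall>u\<in>set us. family E u \<subseteq> W)"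

lemma kernel_carrier: "v \<in> V \<Longrightarrow> Q v \<in> carrier_mat (hdim d (family E v)) (hdim d (family E v))"
  using kernel_pos_def by (rule pos_def_carrier)

text \<open>Commutation is assumed on \<open>V\<close>; it descends to \<open>W\<close> because
  embedding is multiplicative and injective.\<close>

lemma kernel_on_commute:
  assumes "W \<subseteq> V" "u \<in> V" "v \<in> V" "family E u \<subseteq> W" "family E v \<subseteq> W"
  shows "kernel_on W u * kernel_on W v = kernel_on W v * kernel_on W u"
proof (rule embed_op_inj[OF finite_V assms(1) dim_pos])
  show "embed_op d W V (kernel_on W u * kernel_on W v) = embed_op d W V (kernel_on W v * kernel_on W u)"
    using commute[OF assms(2,3)] assms finite_V
    by (simp add: embed_op_mult embed_op_embed_op[OF finite_V])
qed auto

lemma product_on_Nil: "product_on W [] = 1\<^sub>m (hdim d W)"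
  and product_on_Cons: "product_on W (u # us) = kernel_on W u * product_on W us"
  by (simp_all add: kernel_product_def)

lemma product_on_carrier [simp]: "product_on W us \<in> carrier_mat (hdim d W) (hdim d W)"
  by (induction us) (auto simp: product_on_Nil product_on_Cons)

lemma product_on_append: "product_on W (us @ vs) = product_on W us * product_on W vs"
  by (induction us) (simp_all add: product_on_Nil product_on_Cons sq_assoc[of _ "hdim d W"])

lemma product_on_commute:
  assumes "X \<in> carrier_mat (hdim d W) (hdim d W)"
    and "\<And>u. u \<in> set us \<Longrightarrow> X * kernel_on W u = kernel_on W u * X"
  shows "X * product_on W us = product_on W us * X"
  using assms(2)
proof (induction us)
  case Nil
  then show ?case using assms(1) by (simp add: product_on_Nil)
next
  case (Cons u us)
  have "X * product_on W (u # us) = (X * kernel_on W u) * product_on W us"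
    using assms(1) by (simp add: product_on_Cons sq_assoc[of _ "hdim d W"])
  also have "\<dots> = kernel_on W u * (X * product_on W us)"
    using Cons.prems[of u] assms(1) by (simp add: sq_assoc[of _ "hdim d W"])
  also have "\<dots> = product_on W (u # us) * X"
    using Cons assms(1) by (simp add: product_on_Cons sq_assoc[of _ "hdim d W"])
  finally show ?case .
qed

lemma kernel_on_product_on_commute:
  assumes "supported W (u # us)"
  shows "kernel_on W u * product_on W us = product_on W us * kernel_on W u"
proof (rule product_on_commute)
  fix w assume "w \<in> set us"
  then show "kernel_on W u * kernel_on W w = kernel_on W w * kernel_on W u"
    using assms unfolding supported_def by (intro kernel_on_commute) auto
qed simp

lemma product_on_pos_def:
  assumes "supported W us" shows "pos_def (hdim d W) (product_on W us)"
  using assms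
proof (induction us)
  case Nil
  then have W: "finite W" using finite_V by (auto simp: supported_def intro: finite_subset)
  have "pos_def (hdim d W) (1\<^sub>m (hdim d W) * real_diag (hdim d W) (\<lambda>_. 1) * mat_adjoint (1\<^sub>m (hdim d W)))"
    by (rule pos_def_conj_real_diag) (auto simp: unitary_mat_def)
  also have "1\<^sub>m (hdim d W) * real_diag (hdim d W) (\<lambda>_. 1) * mat_adjoint (1\<^sub>m (hdim d W)) = 1\<^sub>m (hdim d W)"
    by (rule eq_matI) (auto simp: index_real_diag)
  finally show ?case by (simp add: product_on_Nil)
next
  case (Cons u us)
  then have "finite W" using finite_V by (auto simp: supported_def intro: finite_subset)
  then have "pos_def (hdim d W) (kernel_on W u)"
    using Cons.prems by (intro pos_def_embed_op kernel_pos_def) (auto simp: supported_def)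
  moreover have "pos_def (hdim d W) (product_on W us)" using Cons by (auto simp: supported_def)
  ultimately show ?case
    unfolding product_on_Cons using kernel_on_product_on_commute[OF Cons.prems]
    by (rule pos_def_commuting_mult)
qed

lemma embed_product_on:
  assumes "supported W us" "W \<subseteq> W'" "W' \<subseteq> V"
  shows "embed_op d W W' (product_on W us) = product_on W' us"
proof -
  have W': "finite W'" using finite_V assms(3) by (rule rev_finite_subset)
  show ?thesis
    using assms(1)
  proof (induction us)
    case Nil
    then show ?case by (simp add: product_on_Nil embed_op_one[OF W' assms(2)])
  next
    case (Cons u us)
    then show ?case
      by (simp add: product_on_Cons embed_op_mult[OF W' assms(2)] embed_op_embed_op[OF W' _ assms(2)] supported_def)
  qed
qed

lemma product_on_perm:
  assumes "mset us = mset vs" "supported W us"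
  shows "product_on W us = product_on W vs"
  using assms
proof (induction us arbitrary: vs)
  case (Cons u us)
  then have "u \<in> set vs" by (metis list.set_intros(1) mset_eq_setD)
  then obtain xs ys where vs: "vs = xs @ u # ys" by (meson split_list)
  have "mset us = mset (xs @ ys)" using Cons.prems(1) unfolding vs by simp
  moreover have "supported W us" using Cons.prems(2) by (simp add: supported_def)
  ultimately have IH: "product_on W us = product_on W (xs @ ys)" using Cons.IH by blast
  have "set (u # xs) \<subseteq> set (u # us)"
    using mset_eq_setD[OF Cons.prems(1)] unfolding vs by auto
  then have "supported W (u # xs)" using Cons.prems(2) unfolding supported_def by blast
  note c = kernel_on_product_on_commute[OF this]
  have "product_on W (u # us) = (kernel_on W u * product_on W xs) * product_on W ys"
    by (simp add: product_on_Cons IH product_on_append sq_assoc[of _ "hdim d W"])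
  also have "\<dots> = product_on W vs"
    unfolding c vs by (simp add: product_on_append product_on_Cons sq_assoc[of _ "hdim d W"])
  finally show ?case .
qed simp

lemma product_on_eq:
  assumes "supported W us" "distinct us" "distinct vs" "set us = set vs"
  shows "product_on W us = product_on W vs"
  using assms set_eq_iff_mset_eq_distinct product_on_perm by blast

text \<open>The kernels of \<open>us\<close> live on \<open>W\<close>, so the trace over
  \<open>v\<close> acts on \<open>Q v\<close> alone, and normalization turns that into the
  identity.\<close>

lemma ptrace_sink:
  assumes v: "v \<in> V" "v \<notin> W" "pa E v \<subseteq> W" and us: "supported W us"
  shows "ptrace d (insert v W) W (product_on (insert v W) (v # us)) = product_on W us"
proof -
  let ?W' = "insert v W"
  have WV: "?W' \<subseteq> V" using v us by (auto simp: supported_def)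
  have fin: "finite ?W'" using finite_V WV by (rule rev_finite_subset)
  have sets: "family E v \<union> W = ?W'" "family E v \<inter> W = pa E v" using v by auto
  have emb: "product_on ?W' us = embed_op d W ?W' (product_on W us)"
    using embed_product_on[OF us subset_insertI WV] by simp
  have "ptrace d ?W' W (product_on ?W' (v # us))
      = embed_op d (pa E v) W (ptrace d (family E v) (pa E v) (Q v)) * embed_op d W W (product_on W us)"
    unfolding product_on_Cons emb using ptrace_mult[OF fin sets(1), of W d "Q v" "product_on W us"]
    unfolding sets(2) by auto
  then show ?thesis
    using fin v unfolding kernel_ptrace[OF v(1)] by (simp add: embed_op_one embed_op_self)
qed

text \<open>The enumeration is an arbitrary choice; \<open>product_on_V\<close> shows that it does
  not matter.\<close>

definition \<omega> :: "complex mat" where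
  "\<omega> = product_on V (SOME us. distinct us \<and> set us = V)"

lemma supported_V: "set us \<subseteq> V \<Longrightarrow> supported V us"
  using family_sub unfolding supported_def by blast

lemma product_on_V:
  assumes "distinct us" "set us = V" shows "product_on V us = \<omega>"
proof -
  have "distinct (SOME us. distinct us \<and> set us = V) \<and> set (SOME us. distinct us \<and> set us = V) = V"
    by (rule someI_ex) (metis finite_V finite_distinct_list)
  then show ?thesis unfolding \<omega>_def using assms supported_V by (intro product_on_eq) auto
qed

text \<open>Induction from \<open>V\<close> downwards: \<open>W\<close> arises from an ancestral set
  with one more vertex by tracing out that vertex, a sink there.\<close>

lemma marg_ancestral:
  assumes "W \<subseteq> V" "ancestral E W" "distinct us" "set us = W"
  shows "marg d V \<omega> W = product_on W us"
  using assms
proof (induction "card (V - W)" arbitrary: W us rule: less_induct)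
  case less
  show ?case
  proof (cases "W = V")
    case True
    then show ?thesis
      using less.prems product_on_V[of us] ptrace_self[OF finite_V product_on_carrier, of us] by (simp add: marg_def)
  next
    case False
    \<comment> \<open>A minimal vertex outside \<open>W\<close> has all its parents in
      \<open>W\<close>, so adding it keeps the set ancestral.\<close>
    then obtain v where v: "v \<in> V - W" "\<And>u. (u, v) \<in> E \<Longrightarrow> u \<notin> V - W"
      using wfE_min[OF finite_acyclic_wf[OF finite_E acyclic_E], of _ "V - W"] less.prems(1) by blast
    then have pa: "pa E v \<subseteq> W" using E_sub by (auto simp: pa_def)
    let ?W' = "insert v W"
    have W': "?W' \<subseteq> V" "ancestral E ?W'" using v pa less.prems by (auto simp: ancestral_def)
    have "card (V - ?W') < card (V - W)" using v finite_V by (intro psubset_card_mono) auto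
    then have IH: "marg d V \<omega> ?W' = product_on ?W' (v # us)"
      using less.hyps[of ?W' "v # us"] W' less.prems v by auto
    have "supported W us" using less.prems unfolding supported_def ancestral_def by auto
    then have "ptrace d ?W' W (product_on ?W' (v # us)) = product_on W us"
      using v pa by (intro ptrace_sink) auto
    moreover have "ptrace d ?W' W (marg d V \<omega> ?W') = marg d V \<omega> W"
      unfolding marg_def using W' by (intro ptrace_ptrace[OF finite_V]) auto
    ultimately show ?thesis using IH by simp
  qed
qed

lemma pd_state: "pd_state d V \<omega>"
proof -
  obtain us where us: "distinct us" "set us = V" using finite_distinct_list[OF finite_V] by blast
  have pd: "pos_def (hdim d V) \<omega>"
    using product_on_pos_def[of V us] supported_V us product_on_V[OF us] by simp
  \<comment> \<open>The empty set is ancestral, so the total trace is that of an empty product of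
    kernels.\<close>
  have "marg d V \<omega> {} = product_on {} []"
    by (rule marg_ancestral) (auto simp: ancestral_def)
  then have "mtrace \<omega> = mtrace (1\<^sub>m (hdim d {}))"
    using mtrace_ptrace[OF finite_V empty_subsetI pos_def_carrier[OF pd]]
    by (simp add: marg_def product_on_Nil)
  also have "\<dots> = 1" by (simp add: mtrace_def hdim_empty)
  finally show ?thesis using pd by (simp add: pd_state_def)
qed

lemma ancestral_nd: "ancestral E (nd V E v)"
  unfolding ancestral_def nd_def de_def pa_def using E_sub
  by (auto intro: trancl_into_trancl)

lemma pa_nd: "v \<in> V \<Longrightarrow> pa E v \<subseteq> nd V E v"
  using E_sub acyclic_E unfolding nd_def de_def pa_def acyclic_def
  by (auto intro: trancl_into_trancl)

text \<open>The family of \<open>v\<close> need not be ancestral, so its marginal is reached through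
  \<open>v\<close> and its non-descendants; there the other kernels meet the family only in
  \<open>pa E v\<close>.\<close>

lemma kernel_eq_cond_op:
  assumes v: "v \<in> V"
  shows "Q v = cond_op d V \<omega> {v} (pa E v)"
proof -
  let ?N = "nd V E v" and ?W = "insert v (nd V E v)" and ?F = "family E v"
  have N: "?N \<subseteq> V" "v \<notin> ?N" by (auto simp: nd_def)
  have WV: "?W \<subseteq> V" using v N by auto
  have fin: "finite ?W" "finite ?F" "finite ?N"
    using finite_V WV N family_sub[OF v] by (auto intro: finite_subset)
  obtain us where us: "distinct us" "set us = ?N" using finite_distinct_list[OF fin(3)] by blast
  have sup: "supported ?N us" using N us ancestral_nd[of v] unfolding supported_def ancestral_def by auto
  have ancW: "ancestral E ?W" using ancestral_nd[of v] pa_nd[OF v] by (auto simp: ancestral_def)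
  have mN: "marg d V \<omega> ?N = product_on ?N us" by (rule marg_ancestral[OF N(1) ancestral_nd us])
  have mW: "marg d V \<omega> ?W = product_on ?W (v # us)"
    using us N by (intro marg_ancestral[OF WV ancW]) auto
  have emb: "product_on ?W us = embed_op d ?N ?W (product_on ?N us)"
    using embed_product_on[OF sup subset_insertI WV] by simp
  have supW: "supported ?W (v # us)"
    using WV us ancW v unfolding supported_def ancestral_def by auto
  have sets: "?N \<union> ?F = ?W" "?N \<inter> ?F = pa E v" "?F \<subseteq> ?W" using pa_nd[OF v] N by auto
  let ?P = "marg d V \<omega> (pa E v)"
  have P: "ptrace d ?N (pa E v) (product_on ?N us) = ?P"
    unfolding mN[symmetric] marg_def using N pa_nd[OF v] by (intro ptrace_ptrace[OF finite_V])
  have mF: "marg d V \<omega> ?F = ptrace d ?W ?F (marg d V \<omega> ?W)"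
    unfolding marg_def using WV sets by (intro ptrace_ptrace[OF finite_V, symmetric])
  note Qc = kernel_carrier[OF v]
  \<comment> \<open>This equation and the next come from the two orders of the product; together
    they show that \<open>Q v\<close> commutes with the embedded marginal.\<close>
  have QP: "marg d V \<omega> ?F = Q v * embed_op d (pa E v) ?F ?P"
    unfolding mF mW product_on_Cons emb
    using ptrace_mult'[OF fin(1) sets(1) order.refl sets(3) product_on_carrier Qc, of us]
    unfolding sets(2) P embed_op_self[OF fin(2) Qc] .
  have PQ: "marg d V \<omega> ?F = embed_op d (pa E v) ?F ?P * Q v"
    unfolding mF mW product_on_Cons kernel_on_product_on_commute[OF supW] unfolding emb
    using ptrace_mult[OF fin(1) sets(1) order.refl sets(3), of d "product_on ?N us" "Q v"]
    unfolding sets(2) P embed_op_self[OF fin(2) Qc] .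
  define H where "H = embed_op d (pa E v) ?F ?P"
  have pdP: "pos_def (hdim d (pa E v)) ?P"
    unfolding P[symmetric] using product_on_pos_def[OF sup] N fin pa_nd[OF v] dim_pos
    by (intro pos_def_ptrace) auto
  have H: "pos_def (hdim d ?F) H"
    unfolding H_def by (intro pos_def_embed_op[OF fin(2) _ pdP]) auto
  note Hh = pos_def_hermitian[OF H]
  let ?R = "spectral_fun (\<lambda>x. 1 / sqrt x) H"
  have R: "?R \<in> carrier_mat (hdim d ?F) (hdim d ?F)"
    using hermitian_carrier[OF hermitian_spectral_fun[OF Hh]] .
  have Hc: "H \<in> carrier_mat (hdim d ?F) (hdim d ?F)" using pos_def_carrier[OF H] .
  have HQ: "H * Q v = Q v * H" using QP PQ by (simp add: H_def)
  have RQ: "?R * Q v = Q v * ?R" by (rule spectral_fun_intertwine[OF Hh Hh Qc HQ])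
  have "?R * H * ?R = spectral_fun (\<lambda>x. 1 / sqrt x * x * (1 / sqrt x)) H"
    using spectral_fun_mult[OF Hh, of "\<lambda>x. 1 / sqrt x" "\<lambda>x. x"]
      spectral_fun_mult[OF Hh, of "\<lambda>x. 1 / sqrt x * x" "\<lambda>x. 1 / sqrt x"]
    by (simp add: spectral_fun_id[OF Hh])
  also have "\<dots> = spectral_fun (\<lambda>_. 1) H"
    by (rule spectral_fun_cong[OF H]) (simp add: real_sqrt_mult_self field_simps)
  also have "\<dots> = 1\<^sub>m (hdim d ?F)" by (rule spectral_fun_const_one[OF Hh])
  finally have RHR: "?R * H * ?R = 1\<^sub>m (hdim d ?F)" .
  have "cond_op d V \<omega> {v} (pa E v) = ?R * (Q v * H) * ?R"
    unfolding cond_op_def Let_def H_def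
    using spectral_fun_embed_op[OF fin(2) Un_upper2 pos_def_hermitian[OF pdP], of "\<lambda>x. 1 / sqrt x"] QP by simp
  also have "\<dots> = (?R * Q v) * (H * ?R)"
    using R Hc Qc by (simp add: sq_assoc[of _ "hdim d ?F"])
  also have "\<dots> = Q v * (?R * H * ?R)"
    unfolding RQ using R Hc Qc by (simp add: sq_assoc[of _ "hdim d ?F"])
  also have "\<dots> = Q v" unfolding RHR using Qc by simp
  finally show ?thesis ..
qed

text \<open>\<open>K\<close> and \<open>X\<close> stay general so that one proof serves both the
  extrinsic and the intrinsic chain. \<open>Suc j\<close> counts vertices, so the latest one is
  \<open>vs ! j\<close>.\<close>

lemma star_chain_eq:
  assumes vs: "distinct vs" "set vs \<subseteq> V" "\<And>j. j < length vs \<Longrightarrow> pa E (vs ! j) \<subseteq> set (take j vs)"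
    and K: "\<And>v. v \<in> set vs \<Longrightarrow> K v = Q v" and X: "X = Q (vs ! 0)" and j: "j < length vs"
  shows "star_chain d E K X vs (Suc j) = product_on (set (take (Suc j) vs)) (take (Suc j) vs)"
  using j
proof (induction j)
  \<comment> \<open>The first vertex of a topological list is a root, so its kernel lives on that
    vertex alone.\<close>
  case 0
  then have v0: "vs ! 0 \<in> V" "pa E (vs ! 0) = {}" "take (Suc 0) vs = [vs ! 0]"
    using vs(2) vs(3)[of 0] by (auto simp: take_Suc_conv_app_nth)
  then show ?case
    using kernel_carrier[OF v0(1)] by (simp add: X product_on_Cons product_on_Nil embed_op_self)
next
  case (Suc j)
  let ?W = "set (take (Suc j) vs)" and ?v = "vs ! Suc j" and ?us = "take (Suc j) vs"
  have t: "take (Suc (Suc j)) vs = ?us @ [?v]" using Suc.prems by (rule take_Suc_conv_app_nth)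
  have W': "set (take (Suc (Suc j)) vs) = insert ?v ?W" unfolding t by simp
  have v: "?v \<in> set vs" "?v \<in> V" using Suc.prems vs(2) by auto
  have WV: "insert ?v ?W \<subseteq> V" using v vs(2) set_take_subset[of "Suc j" vs] by auto
  have fam: "family E u \<subseteq> ?W" if u: "u \<in> ?W" for u
  proof -
    obtain i where i: "i < Suc j" "u = vs ! i" using u Suc.prems by (auto simp: in_set_conv_nth)
    have "pa E u \<subseteq> set (take i vs)" using vs(3)[of i] i Suc.prems by auto
    also have "\<dots> \<subseteq> ?W" using i by (intro set_take_subset_set_take) simp
    finally show ?thesis using u by simp
  qed
  have famv: "family E ?v \<subseteq> insert ?v ?W" using vs(3)[OF Suc.prems] by auto
  have sup: "supported ?W ?us" using fam WV by (auto simp: supported_def)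
  have sup': "supported (insert ?v ?W) (?v # ?us)"
    using fam famv WV unfolding supported_def by fastforce
  have "star_chain d E K X vs (Suc (Suc j))
      = kernel_on (insert ?v ?W) ?v \<star> product_on (insert ?v ?W) ?us"
    using Suc K[OF v(1)] embed_product_on[OF sup subset_insertI WV] unfolding star_chain.simps W' by auto
  also have "\<dots> = kernel_on (insert ?v ?W) ?v * product_on (insert ?v ?W) ?us"
    using sup' by (intro star_commuting[OF product_on_pos_def]
      kernel_on_product_on_commute embed_op_carrier) (auto simp: supported_def)
  \<comment> \<open>The star product puts the newest kernel in front, the list puts it last.\<close>
  also have "\<dots> = product_on (insert ?v ?W) (?us @ [?v])"
    unfolding product_on_Cons[symmetric] by (rule product_on_perm[OF _ sup']) simp
  finally show ?case unfolding t by simp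
qed

text \<open>For empty \<open>V\<close> there is no first vertex to constrain \<open>X\<close>; both
  sides are then the scalar 1.\<close>

lemma star_chain_enumeration:
  assumes r: "topological_ordering V E r" and K: "\<And>v. v \<in> V \<Longrightarrow> K v = Q v"
    and X: "V \<noteq> {} \<Longrightarrow> X = Q (enumeration V r ! 0)"
  shows "star_chain d E K X (enumeration V r) (card V) = \<omega>"
proof -
  let ?vs = "enumeration V r"
  have lin: "strict_linear_order_on V r" using r by (simp add: topological_ordering_def)
  note vs = enumeration_props[OF finite_V lin]
  have len: "length ?vs = card V" using vs distinct_card by metis
  show ?thesis
  proof (cases "card V")
    case 0
    then have "V = {}" using finite_V by simp
    then show ?thesis using product_on_V[of "[]"] by (simp add: product_on_Nil)
  next
    case (Suc n)
    then have "V \<noteq> {}" by auto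
    have "star_chain d E K X ?vs (Suc n) = product_on (set (take (Suc n) ?vs)) (take (Suc n) ?vs)"
      using Suc len vs K X[OF \<open>V \<noteq> {}\<close>] by (intro star_chain_eq topological_enumeration[OF finite_V r]) auto
    then show ?thesis using Suc len vs product_on_V[of ?vs] by simp
  qed
qed

lemma kernel_state_eq: "topological_ordering V E r \<Longrightarrow> kernel_state d V E r Q = \<omega>"
  unfolding kernel_state_def Let_def by (rule star_chain_enumeration) auto

text \<open>The chain starts with a marginal instead of a conditional; the first vertex is a root
  and forms an ancestral set, so this marginal is its kernel.\<close>

lemma intrinsic_factorization_eq:
  assumes r: "topological_ordering V E r"
  shows "intrinsic_factorization d V E r \<omega> = \<omega>"
  unfolding intrinsic_factorization_def Let_def
proof (rule star_chain_enumeration[OF r])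
  let ?v = "enumeration V r ! 0"
  assume "V \<noteq> {}"
  have lin: "strict_linear_order_on V r" using r by (simp add: topological_ordering_def)
  note vs = enumeration_props[OF finite_V lin]
  have ne: "enumeration V r \<noteq> []" using vs(2) \<open>V \<noteq> {}\<close> by auto
  then have v: "?v \<in> V" using vs(2) by (metis length_greater_0_conv nth_mem)
  have pa: "pa E ?v = {}" using topological_enumeration[OF finite_V r, of 0] ne by auto
  have "marg d V \<omega> {?v} = product_on {?v} [?v]"
    using v pa by (intro marg_ancestral) (auto simp: ancestral_def)
  then show "marg d V \<omega> {?v} = Q ?v"
    using kernel_carrier[OF v] pa by (simp add: product_on_Cons product_on_Nil embed_op_self)
qed (simp add: kernel_eq_cond_op[symmetric])

text \<open>A kernel is assigned to \<open>C\<close> if its family fits there and to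
  \<open>D\<close> otherwise. Listing the two groups in either order gives both factorizations of
  the marginal.\<close>

lemma q_indep_split:
  assumes W: "C \<union> D \<subseteq> V" "ancestral E (C \<union> D)" and A: "A \<subseteq> C" and B: "B \<subseteq> D" and S: "C \<inter> D = S"
    and split: "\<And>u. u \<in> C \<union> D \<Longrightarrow> family E u \<subseteq> C \<or> family E u \<subseteq> D"
  shows "q_indep d V \<omega> A B S"
proof -
  let ?W = "C \<union> D"
  have fin: "finite ?W" using finite_V W(1) by (rule rev_finite_subset)
  obtain us where us: "distinct us" "set us = {u \<in> ?W. family E u \<subseteq> C}"
    using finite_distinct_list[of "{u \<in> ?W. family E u \<subseteq> C}"] fin by auto
  obtain vs where vs: "distinct vs" "set vs = {u \<in> ?W. \<not> family E u \<subseteq> C}"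
    using finite_distinct_list[of "{u \<in> ?W. \<not> family E u \<subseteq> C}"] fin by auto
  have supC: "supported C us" using W us by (auto simp: supported_def)
  have supD: "supported D vs" using W vs split unfolding supported_def by blast
  have F: "embed_op d C ?W (product_on C us) = product_on ?W us"
    using embed_product_on[OF supC _ W(1)] by auto
  have G: "embed_op d D ?W (product_on D vs) = product_on ?W vs"
    using embed_product_on[OF supD _ W(1)] by auto
  have m1: "marg d V \<omega> ?W = product_on ?W (us @ vs)"
    using us vs by (intro marg_ancestral[OF W]) auto
  have m2: "marg d V \<omega> ?W = product_on ?W (vs @ us)"
    using us vs by (intro marg_ancestral[OF W]) auto
  show ?thesis
    using q_indep_of_factorization[OF finite_V dim_pos pd_state refl W(1) S A B
        product_on_pos_def[OF supC] product_on_pos_def[OF supD]]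
    unfolding F G using m1 m2 by (simp add: product_on_append)
qed

section \<open>The three Markov properties\<close>

lemma ordered_markov:
  assumes r: "topological_ordering V E r"
  shows "ordered_markov d V E r \<omega>"
  unfolding ordered_markov_def
proof
  fix v assume v: "v \<in> V"
  let ?P = "pr V r v"
  have tr: "trans r" and irr: "irrefl r" and Er: "E \<subseteq> r" and rV: "r \<subseteq> V \<times> V"
    using r by (auto simp: topological_ordering_def strict_linear_order_on_def)
  have P: "?P \<subseteq> V" "v \<notin> ?P" "pa E v \<subseteq> ?P"
    using Er rV irr by (auto simp: pr_def pa_def irrefl_def)
  have fam: "family E u \<subseteq> ?P" if "u \<in> ?P" for u
    using that Er rV transD[OF tr] unfolding pr_def pa_def by blast
  \<comment> \<open>The cover is the family of \<open>v\<close> and its predecessors, which overlap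
    in \<open>pa E v\<close>; the family of each predecessor stays among the predecessors.\<close>
  show "q_indep d V \<omega> {v} (?P - pa E v) (pa E v)"
    using v P fam family_sub[OF v]
    by (intro q_indep_split[of "family E v" ?P]) (auto simp: ancestral_def)
qed

lemma local_markov: "local_markov d V E \<omega>"
  unfolding local_markov_def
proof
  fix v assume v: "v \<in> V"
  let ?N = "nd V E v"
  have N: "?N \<subseteq> V" "v \<notin> ?N" "pa E v \<subseteq> ?N" using pa_nd[OF v] by (auto simp: nd_def)
  have fam: "family E u \<subseteq> ?N" if "u \<in> ?N" for u
    using that ancestral_nd[of v] by (auto simp: ancestral_def)
  \<comment> \<open>The same cover with the non-descendants in place of the predecessors.\<close>
  show "q_indep d V \<omega> {v} (?N - pa E v) (pa E v)"
    using v N fam family_sub[OF v]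
    by (intro q_indep_split[of "family E v" ?N]) (auto simp: ancestral_def)
qed

lemma global_markov: "global_markov d V E \<omega>"
  unfolding global_markov_def
proof (intro allI impI, elim conjE)
  fix A B S
  assume "A \<subseteq> V" "B \<subseteq> V" "S \<subseteq> V" "A \<inter> B = {}" "A \<inter> S = {}" "B \<inter> S = {}" "d_separated V E A B S"
  from d_separated_split[OF dag this] obtain C D where
    "C \<union> D \<subseteq> V" "ancestral E (C \<union> D)" "C \<inter> D = S" "A \<subseteq> C" "B \<subseteq> D"
    "\<forall>u\<in>C \<union> D. family E u \<subseteq> C \<or> family E u \<subseteq> D" by blast
  then show "q_indep d V \<omega> A B S" by (intro q_indep_split[of C D]) auto
qed

end

theorem corollary4p3:
  fixes V :: "'v set" and E :: "('v \<times> 'v) set" and d :: "'v \<Rightarrow> nat" and Q :: "'v \<Rightarrow> complex mat"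
  assumes dag: "dag V E"
    and kernels: "quantum_kernels d V E Q"
    and commute: "\<And>u v. u \<in> V \<Longrightarrow> v \<in> V \<Longrightarrow>
      embed_op d (family E u) V (Q u) * embed_op d (family E v) V (Q v) =
      embed_op d (family E v) V (Q v) * embed_op d (family E u) V (Q u)"
  shows "\<exists>\<omega>. pd_state d V \<omega> \<and>
    (\<forall>us. distinct us \<and> set us = V \<longrightarrow> kernel_product d V E Q us = \<omega>) \<and>
    (\<forall>r. topological_ordering V E r \<longrightarrow> kernel_state d V E r Q = \<omega>) \<and>
    (\<forall>v\<in>V. Q v = cond_op d V \<omega> {v} (pa E v)) \<and>
    (\<forall>r. topological_ordering V E r \<longrightarrow> \<omega> = intrinsic_factorization d V E r \<omega>) \<and>
    (\<forall>r. topological_ordering V E r \<longrightarrow> ordered_markov d V E r \<omega>) \<and>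
    local_markov d V E \<omega> \<and>
    global_markov d V E \<omega>"
proof -
  interpret commuting_kernels V E d Q by unfold_locales (fact dag kernels commute)+
  show ?thesis
    using pd_state product_on_V kernel_state_eq kernel_eq_cond_op intrinsic_factorization_eq
      ordered_markov local_markov global_markov
    by (intro exI[of _ \<omega>]) auto
qed

end
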